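(* Let $(W,S)$ be a finite Coxeter group with longest element $w_0$, let $\Gamma$ be a totally ordered abelian group, and let $L:W\to\Gamma$ be a weight function with $L(s)>0$ for all $s\in S$. Assume that $(W,S,L)$ satisfies Lusztig's conjectures $P_1$, $P_4$ and $P_8$. For $y\in W$ and $n\in\mathbb{Z}$ write $T_{w_0}^nC_y=\sum_{x\in W}\lambda^{(n)}_{x,y}C_x$ with $\lambda_{x,y}^{(n)}\in A$. Let $n\in\mathbb{Z}$ and let $x$ and $y$ be two elements of $W$ such that $x\leqslant_{\mathcal{L}}y$. Then: (a) If $n\ge0$, then $\deg\lambda^{(n)}_{x,y}\le n(\mathbf{a}(x)-\mathbf{a}(w_0x))$. If moreover $x<_{\mathcal{L}}y$, then $\deg\lambda^{(n)}_{x,y}<n(\mathbf{a}(x)-\mathbf{a}(w_0x))$. (b) If $n\le0$, then $\deg\lambda^{(n)}_{x,y}\le n(\mathbf{a}(y)-\mathbf{a}(w_0y))$. If moreover $x<_{\mathcal{L}}y$, then $\deg\lambda^{(n)}_{x,y}<n(\mathbf{a}(y)-\mathbf{a}(w_0y))$. (c) If $n$ is even and $x\sim_{\mathcal{L}}y$, then $\lambda^{(n)}_{x,y}=\delta_{x,y}\,v^{n(\mathbf{a}(x)-\mathbf{a}(w_0x))}$.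
   Context: $\ell$ is the length function of $(W,S)$. A weight function $L:W\to\Gamma$ is a function with $L(ww')=L(w)+L(w')$ whenever $\ell(ww')=\ell(w)+\ell(w')$. $A=\mathbb{Z}[\Gamma]$ is the group ring of $\Gamma$, written exponentially with $\mathbb{Z}$-basis $(v^\gamma)_{\gamma\in\Gamma}$, $v^\gamma v^{\gamma'}=v^{\gamma+\gamma'}$. For $0\ne a=\sum a_\gamma v^\gamma\in A$, $\deg a=\max\{\gamma\mid a_\gamma\neq0\}$, and $\deg0=-\infty$. $A_{<0}=\bigoplus_{\gamma<0}\mathbb{Z}v^\gamma$, and $a\mapsto\bar a$ is the ring automorphism $v^\gamma\mapsto v^{-\gamma}$. The Hecke algebra $\mathcal{H}$ is the associative $A$-algebra with basis $(T_w)_{w\in W}$ such that $T_wT_{w'}=T_{ww'}$ if $\ell(ww')=\ell(w)+\ell(w')$ and $T_s^2=1+(v^{L(s)}-v^{-L(s)})T_s$ for $s\in S$. Bar involution: $\overline{\sum_wa_wT_w}=\sum_w\bar a_wT_{w^{-1}}^{-1}$. The Kazhdan-Lusztig basis $(C_w)_{w\in W}$ is characterized by $\overline{C_w}=C_w$ and $C_w\in T_w+\bigoplus_{y\in W}A_{<0}T_y$. Let $\tau:\mathcal{H}\to A$ be the $A$-linear map with $\tau(T_w)=\delta_{1,w}$. Write $C_xC_y=\sum_{z}h_{x,y,z}C_z$ with $h_{x,y,z}\in A$. Set $\mathbf{a}(z)=\max_{x,y\in W}\deg h_{x,y,z}$, let $\gamma_{x,y,z^{-1}}\in\mathbb{Z}$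 be the coefficient of $v^{\mathbf{a}(z)}$ in $h_{x,y,z}$, and let $\Delta(z)=-\deg\tau(C_z)$. $\leqslant_{\mathcal{L}}$ (resp. $\leqslant_{\mathcal{R}}$, resp. $\leqslant_{\mathcal{LR}}$) is the preorder on $W$ generated by: $x\leqslant y$ whenever, for some $h\in\mathcal{H}$, $C_x$ appears with nonzero coefficient in $hC_y$ (resp. in $C_yh$, resp. in $hC_y$ or $C_yh$). $\sim_{\mathcal{L}},\sim_{\mathcal{R}},\sim_{\mathcal{LR}}$ are the associated equivalence relations; $x<_{\mathcal{L}}y$ means $x\leqslant_{\mathcal{L}}y$ and not $x\sim_{\mathcal{L}}y$. The conjectures are: $P_1$: $\mathbf{a}(z)\le\Delta(z)$ for all $z\in W$. $P_4$: if $z'\leqslant_{\mathcal{LR}}z$ then $\mathbf{a}(z)\le\mathbf{a}(z')$ (hence $\mathbf{a}$ is constant on the classes of $\sim_{\mathcal{LR}}$). $P_8$: if $x,y,z\in W$ satisfy $\gamma_{x,y,z}\neq0$, then $x\sim_{\mathcal{L}}y^{-1}$, $y\sim_{\mathcal{L}}z^{-1}$ and $z\sim_{\mathcal{L}}x^{-1}$. *)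

theory Defs
  imports "HOL-Algebra.Algebra" "HOL-Library.Poly_Mapping" "HOL-Library.Extended"
begin

section \<open>Coxeter systems and weight functions\<close>

definition word_prod :: "('w, 'b) monoid_scheme \<Rightarrow> 'w list \<Rightarrow> 'w" where
  "word_prod W ws = foldr (\<lambda>s u. s \<otimes>\<^bsub>W\<^esub> u) ws \<one>\<^bsub>W\<^esub>"

text \<open>Insertion of a Coxeter relator \<open>(s t)\<^sup>m\<close>, with \<open>m\<close> the order of \<open>s t\<close> (and \<open>m = 0\<close>,
  i.e. no relator, if that order is infinite), into a word.  The case \<open>s = t\<close> is \<open>s s\<close>.\<close>

definition insert_relator :: "('w, 'b) monoid_scheme \<Rightarrow> 'w set \<Rightarrow> 'w list \<Rightarrow> 'w list \<Rightarrow> bool" where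
  "insert_relator W S us vs \<longleftrightarrow>
     (\<exists>xs ys. \<exists>s\<in>S. \<exists>t\<in>S. us = xs @ ys \<and>
        vs = xs @ concat (replicate (group.ord W (s \<otimes>\<^bsub>W\<^esub> t)) [s, t]) @ ys)"

text \<open>\<open>W\<close> has the presentation with generators \<open>S\<close> and relators \<open>(s t)\<^sup>m\<close>.  As the relators
  include \<open>s s\<close>, formal inverses of generators are not needed, so the presentation may be
  stated with positive words: every word representing 1 can be transformed into the
  empty word by inserting and deleting relators.\<close>

locale coxeter_system = group W
  for W :: "('w, 'b) monoid_scheme" (structure) and S :: "'w set" +
  assumes gens: "S \<subseteq> carrier W" "generate W S = carrier W"
    and involutions: "s \<in> S \<Longrightarrow> ord s = 2"
    and presentation: "ws \<in> lists S \<Longrightarrow> word_prod W ws = \<one> \<Longrightarrow>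
      equivclp (insert_relator W S) ws []"

definition cox_length :: "('w, 'b) monoid_scheme \<Rightarrow> 'w set \<Rightarrow> 'w \<Rightarrow> nat" where
  "cox_length W S w = (LEAST k. \<exists>ws\<in>lists S. length ws = k \<and> word_prod W ws = w)"

definition longest_element :: "('w, 'b) monoid_scheme \<Rightarrow> 'w set \<Rightarrow> 'w \<Rightarrow> bool" where
  "longest_element W S w0 \<longleftrightarrow> is_arg_max (cox_length W S) (\<lambda>w. w \<in> carrier W) w0"

definition weight_function ::
    "('w, 'b) monoid_scheme \<Rightarrow> 'w set \<Rightarrow> ('w \<Rightarrow> 'g::linordered_ab_group_add) \<Rightarrow> bool" where
  "weight_function W S L \<longleftrightarrow>
     (\<forall>w\<in>carrier W. \<forall>w'\<in>carrier W.
        cox_length W S (w \<otimes>\<^bsub>W\<^esub> w') = cox_length W S w + cox_length W S w' \<longrightarrow>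
        L (w \<otimes>\<^bsub>W\<^esub> w') = L w + L w')"

section \<open>The group ring of \<open>\<Gamma>\<close>\<close>

text \<open>The multiplication of \<^typ>\<open>'g \<Rightarrow>\<^sub>0 int\<close> is the convolution product, so that this is
  the group ring of the additively written group \<open>'g\<close>.\<close>

type_synonym 'g group_ring = "'g \<Rightarrow>\<^sub>0 int"

definition v_pow :: "'g \<Rightarrow> 'g group_ring" where
  "v_pow \<gamma> = Poly_Mapping.single \<gamma> 1"

definition deg :: "'g::linordered_ab_group_add group_ring \<Rightarrow> 'g extended" where
  "deg a = (if a = 0 then Minf else Fin (Max (Poly_Mapping.keys a)))"

definition A_neg :: "'g::linordered_ab_group_add group_ring set" where
  "A_neg = {a. Poly_Mapping.keys a \<subseteq> {..<0}}"

definition A_bar :: "'g::linordered_ab_group_add group_ring \<Rightarrow> 'g group_ring" where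
  "A_bar a = Poly_Mapping.map_key uminus a"

definition int_mult :: "int \<Rightarrow> 'g::ab_group_add \<Rightarrow> 'g" where
  "int_mult n \<gamma> = (if n \<ge> 0 then (\<Sum>i<nat n. \<gamma>) else - (\<Sum>i<nat (- n). \<gamma>))"

section \<open>The Hecke algebra and its Kazhdan--Lusztig basis\<close>

text \<open>The underlying \<open>A\<close>-module of the Hecke algebra is realised as the free module on the
  elements of \<open>W\<close>; \<open>T\<^sub>w\<close> is the basis vector at \<open>w\<close>.  The multiplication of the Hecke algebra
  is that of a monoid structure \<open>H\<close> on this module.  The ring multiplication of the type class
  on \<^typ>\<open>'g group_ring\<close> is used for scalars only.\<close>

type_synonym ('w, 'g) hecke = "'w \<Rightarrow>\<^sub>0 'g group_ring"

definition free_module ::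
    "('w, 'b) monoid_scheme \<Rightarrow> ('w, 'g::linordered_ab_group_add) hecke set" where
  "free_module W = {h. Poly_Mapping.keys h \<subseteq> carrier W}"

definition scale :: "'g::linordered_ab_group_add group_ring \<Rightarrow> ('w, 'g) hecke \<Rightarrow> ('w, 'g) hecke" where
  "scale a h = Poly_Mapping.map (\<lambda>b. a * b) h"

definition T :: "'w \<Rightarrow> ('w, 'g::linordered_ab_group_add) hecke" where
  "T w = Poly_Mapping.single w 1"

locale hecke_algebra = monoid H
  for W :: "('w, 'b) monoid_scheme" and S :: "'w set"
    and L :: "'w \<Rightarrow> 'g::linordered_ab_group_add"
    and H :: "('w, 'g) hecke monoid" (structure) +
  assumes carrier_eq: "carrier H = free_module W"
    and distrib_left: "\<lbrakk>h \<in> carrier H; h' \<in> carrier H; k \<in> carrier H\<rbrakk>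
      \<Longrightarrow> (h + h') \<otimes> k = h \<otimes> k + h' \<otimes> k"
    and distrib_right: "\<lbrakk>h \<in> carrier H; k \<in> carrier H; k' \<in> carrier H\<rbrakk>
      \<Longrightarrow> h \<otimes> (k + k') = h \<otimes> k + h \<otimes> k'"
    and scale_left: "\<lbrakk>h \<in> carrier H; k \<in> carrier H\<rbrakk> \<Longrightarrow> scale a h \<otimes> k = scale a (h \<otimes> k)"
    and scale_right: "\<lbrakk>h \<in> carrier H; k \<in> carrier H\<rbrakk> \<Longrightarrow> h \<otimes> scale a k = scale a (h \<otimes> k)"
    and T_mult: "\<lbrakk>w \<in> carrier W; w' \<in> carrier W;
        cox_length W S (w \<otimes>\<^bsub>W\<^esub> w') = cox_length W S w + cox_length W S w'\<rbrakk>
      \<Longrightarrow> T w \<otimes> T w' = T (w \<otimes>\<^bsub>W\<^esub> w')"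
    and T_quadratic: "s \<in> S \<Longrightarrow>
      T s \<otimes> T s = \<one> + scale (v_pow (L s) - v_pow (- L s)) (T s)"

definition hecke_bar ::
    "('w, 'b) monoid_scheme \<Rightarrow> ('w, 'g::linordered_ab_group_add) hecke monoid \<Rightarrow>
     ('w, 'g) hecke \<Rightarrow> ('w, 'g) hecke" where
  "hecke_bar W H h =
     (\<Sum>w\<in>carrier W. scale (A_bar (Poly_Mapping.lookup h w)) (inv\<^bsub>H\<^esub> (T (inv\<^bsub>W\<^esub> w))))"

definition tau :: "('w, 'b) monoid_scheme \<Rightarrow> ('w, 'g::linordered_ab_group_add) hecke \<Rightarrow> 'g group_ring" where
  "tau W h = Poly_Mapping.lookup h \<one>\<^bsub>W\<^esub>"

text \<open>Linear combinations of, and coordinates with respect to, a family \<open>B\<close> indexed by the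
  finite group \<open>W\<close>.  Coordinate vectors are again elements of the free module on \<open>W\<close>.\<close>

definition lincomb ::
    "('w, 'b) monoid_scheme \<Rightarrow> ('w \<Rightarrow> ('w, 'g::linordered_ab_group_add) hecke) \<Rightarrow>
     ('w, 'g) hecke \<Rightarrow> ('w, 'g) hecke" where
  "lincomb W B c = (\<Sum>w\<in>carrier W. scale (Poly_Mapping.lookup c w) (B w))"

definition is_basis ::
    "('w, 'b) monoid_scheme \<Rightarrow> ('w \<Rightarrow> ('w, 'g::linordered_ab_group_add) hecke) \<Rightarrow> bool" where
  "is_basis W B \<longleftrightarrow> (\<forall>w\<in>carrier W. B w \<in> free_module W) \<and>
     (\<forall>h\<in>free_module W. \<exists>!c. c \<in> free_module W \<and> h = lincomb W B c)"

definition coord ::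
    "('w, 'b) monoid_scheme \<Rightarrow> ('w \<Rightarrow> ('w, 'g::linordered_ab_group_add) hecke) \<Rightarrow>
     ('w, 'g) hecke \<Rightarrow> 'w \<Rightarrow> 'g group_ring" where
  "coord W B h = Poly_Mapping.lookup (THE c. c \<in> free_module W \<and> h = lincomb W B c)"

definition KL_basis ::
    "('w, 'b) monoid_scheme \<Rightarrow> ('w, 'g::linordered_ab_group_add) hecke monoid \<Rightarrow>
     ('w \<Rightarrow> ('w, 'g) hecke) \<Rightarrow> bool" where
  "KL_basis W H C \<longleftrightarrow> is_basis W C \<and>
     (\<forall>w\<in>carrier W. hecke_bar W H (C w) = C w \<and>
        (\<forall>y\<in>carrier W. Poly_Mapping.lookup (C w - T w) y \<in> A_neg))"

section \<open>Structure constants, the functions \<open>a\<close> and \<open>\<Delta>\<close>, and cells\<close>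

definition h_coeff ::
    "('w, 'b) monoid_scheme \<Rightarrow> ('w, 'g::linordered_ab_group_add) hecke monoid \<Rightarrow>
     ('w \<Rightarrow> ('w, 'g) hecke) \<Rightarrow> 'w \<Rightarrow> 'w \<Rightarrow> 'w \<Rightarrow> 'g group_ring" where
  "h_coeff W H C x y z = coord W C (C x \<otimes>\<^bsub>H\<^esub> C y) z"

text \<open>The maximum defining \<open>a\<close> is attained at an element of \<open>\<Gamma>\<close>, since \<open>C\<^sub>1\<close> is the
  identity of the Hecke algebra and hence \<open>h\<^sub>1\<^sub>,\<^sub>z\<^sub>,\<^sub>z = 1\<close>; the default value 0 is never taken.\<close>

definition a_fun ::
    "('w, 'b) monoid_scheme \<Rightarrow> ('w, 'g::linordered_ab_group_add) hecke monoid \<Rightarrow>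
     ('w \<Rightarrow> ('w, 'g) hecke) \<Rightarrow> 'w \<Rightarrow> 'g" where
  "a_fun W H C z =
     (case Max ((\<lambda>(x, y). deg (h_coeff W H C x y z)) ` (carrier W \<times> carrier W)) of
        Fin \<gamma> \<Rightarrow> \<gamma> | _ \<Rightarrow> 0)"

text \<open>In \<open>gamma_coeff W H C x y z\<close> the third index is inverted: it is the coefficient of
  \<open>v\<close> to the power \<open>a(z\<^sup>-\<^sup>1)\<close> in the structure constant at \<open>z\<^sup>-\<^sup>1\<close>.\<close>

definition gamma_coeff ::
    "('w, 'b) monoid_scheme \<Rightarrow> ('w, 'g::linordered_ab_group_add) hecke monoid \<Rightarrow>
     ('w \<Rightarrow> ('w, 'g) hecke) \<Rightarrow> 'w \<Rightarrow> 'w \<Rightarrow> 'w \<Rightarrow> int" where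
  "gamma_coeff W H C x y z =
     Poly_Mapping.lookup (h_coeff W H C x y (inv\<^bsub>W\<^esub> z)) (a_fun W H C (inv\<^bsub>W\<^esub> z))"

definition Delta ::
    "('w, 'b) monoid_scheme \<Rightarrow> ('w \<Rightarrow> ('w, 'g::linordered_ab_group_add) hecke) \<Rightarrow> 'w \<Rightarrow> 'g extended" where
  "Delta W C z = - deg (tau W (C z))"

definition left_step ::
    "('w, 'b) monoid_scheme \<Rightarrow> ('w, 'g::linordered_ab_group_add) hecke monoid \<Rightarrow>
     ('w \<Rightarrow> ('w, 'g) hecke) \<Rightarrow> 'w \<Rightarrow> 'w \<Rightarrow> bool" where
  "left_step W H C x y \<longleftrightarrow> x \<in> carrier W \<and> y \<in> carrier W \<and>
     (\<exists>h\<in>carrier H. coord W C (h \<otimes>\<^bsub>H\<^esub> C y) x \<noteq> 0)"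

definition right_step ::
    "('w, 'b) monoid_scheme \<Rightarrow> ('w, 'g::linordered_ab_group_add) hecke monoid \<Rightarrow>
     ('w \<Rightarrow> ('w, 'g) hecke) \<Rightarrow> 'w \<Rightarrow> 'w \<Rightarrow> bool" where
  "right_step W H C x y \<longleftrightarrow> x \<in> carrier W \<and> y \<in> carrier W \<and>
     (\<exists>h\<in>carrier H. coord W C (C y \<otimes>\<^bsub>H\<^esub> h) x \<noteq> 0)"

definition le_L ::
    "('w, 'b) monoid_scheme \<Rightarrow> ('w, 'g::linordered_ab_group_add) hecke monoid \<Rightarrow>
     ('w \<Rightarrow> ('w, 'g) hecke) \<Rightarrow> 'w \<Rightarrow> 'w \<Rightarrow> bool" where
  "le_L W H C = (left_step W H C)\<^sup>*\<^sup>*"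

definition le_LR ::
    "('w, 'b) monoid_scheme \<Rightarrow> ('w, 'g::linordered_ab_group_add) hecke monoid \<Rightarrow>
     ('w \<Rightarrow> ('w, 'g) hecke) \<Rightarrow> 'w \<Rightarrow> 'w \<Rightarrow> bool" where
  "le_LR W H C = (\<lambda>x y. left_step W H C x y \<or> right_step W H C x y)\<^sup>*\<^sup>*"

definition sim_L ::
    "('w, 'b) monoid_scheme \<Rightarrow> ('w, 'g::linordered_ab_group_add) hecke monoid \<Rightarrow>
     ('w \<Rightarrow> ('w, 'g) hecke) \<Rightarrow> 'w \<Rightarrow> 'w \<Rightarrow> bool" where
  "sim_L W H C x y \<longleftrightarrow> le_L W H C x y \<and> le_L W H C y x"

definition less_L ::
    "('w, 'b) monoid_scheme \<Rightarrow> ('w, 'g::linordered_ab_group_add) hecke monoid \<Rightarrow>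
     ('w \<Rightarrow> ('w, 'g) hecke) \<Rightarrow> 'w \<Rightarrow> 'w \<Rightarrow> bool" where
  "less_L W H C x y \<longleftrightarrow> le_L W H C x y \<and> \<not> sim_L W H C x y"

section \<open>Lusztig's conjectures and the action of powers of \<open>T\<^sub>w\<^sub>0\<close>\<close>

definition P1 ::
    "('w, 'b) monoid_scheme \<Rightarrow> ('w, 'g::linordered_ab_group_add) hecke monoid \<Rightarrow>
     ('w \<Rightarrow> ('w, 'g) hecke) \<Rightarrow> bool" where
  "P1 W H C \<longleftrightarrow> (\<forall>z\<in>carrier W. Fin (a_fun W H C z) \<le> Delta W C z)"

definition P4 ::
    "('w, 'b) monoid_scheme \<Rightarrow> ('w, 'g::linordered_ab_group_add) hecke monoid \<Rightarrow>
     ('w \<Rightarrow> ('w, 'g) hecke) \<Rightarrow> bool" where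
  "P4 W H C \<longleftrightarrow> (\<forall>z\<in>carrier W. \<forall>z'\<in>carrier W.
     le_LR W H C z' z \<longrightarrow> a_fun W H C z \<le> a_fun W H C z')"

definition P8 ::
    "('w, 'b) monoid_scheme \<Rightarrow> ('w, 'g::linordered_ab_group_add) hecke monoid \<Rightarrow>
     ('w \<Rightarrow> ('w, 'g) hecke) \<Rightarrow> bool" where
  "P8 W H C \<longleftrightarrow> (\<forall>x\<in>carrier W. \<forall>y\<in>carrier W. \<forall>z\<in>carrier W.
     gamma_coeff W H C x y z \<noteq> 0 \<longrightarrow>
       sim_L W H C x (inv\<^bsub>W\<^esub> y) \<and> sim_L W H C y (inv\<^bsub>W\<^esub> z) \<and> sim_L W H C z (inv\<^bsub>W\<^esub> x))"

definition lambda_coeff ::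
    "('w, 'b) monoid_scheme \<Rightarrow> ('w, 'g::linordered_ab_group_add) hecke monoid \<Rightarrow>
     ('w \<Rightarrow> ('w, 'g) hecke) \<Rightarrow> 'w \<Rightarrow> int \<Rightarrow> 'w \<Rightarrow> 'w \<Rightarrow> 'g group_ring" where
  "lambda_coeff W H C w0 n x y = coord W C (T w0 [^]\<^bsub>H\<^esub> n \<otimes>\<^bsub>H\<^esub> C y) x"

end

theory Submission
  imports Defs
begin

text \<open>
  Everything rests on one description of the coordinates with respect to \<open>(C\<^sub>w)\<close>.  Let \<open>\<sigma>\<close> be
  the \<open>A\<close>-linear anti-automorphism \<open>T\<^sub>w \<mapsto> (-1)\<^bsup>\<ell>(w)\<^esup> T\<^sub>w\<^sup>-\<^sup>1\<close> of the Hecke algebra and let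
  \<open>\<phi>(h) = \<tau>(h T\<^sub>w\<^sub>0)\<close>.  Then
  \<open>\<phi>(C\<^sub>x \<sigma>(C\<^bsub>w0 z\<^esub>)) = \<plusminus> \<delta>\<^sub>x\<^sub>z\<close> (lemma \<open>phi_dual\<close>): the left-hand side is invariant under the bar
  map because \<open>\<phi>\<close>, \<open>\<sigma>\<close> and the basis are compatible with it, and expanding both factors in
  the basis \<open>(T\<^sub>w)\<close> shows that it is congruent to \<open>\<plusminus> \<delta>\<^sub>x\<^sub>z\<close> modulo \<open>A\<^bsub><0\<^esub>\<close>, which contains no
  nonzero bar-invariant element.  So the coordinate of \<open>h\<close> at \<open>x\<close> is \<open>\<plusminus> \<phi>(h \<sigma>(C\<^bsub>w0 x\<^esub>))\<close>, and the
  symmetry \<open>\<phi> \<circ> \<sigma> = \<plusminus> \<phi>\<close> turns into three facts: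

  \<^item> left and right multiplication steps are reversed by \<open>x \<mapsto> w\<^sub>0 x\<close> (\<open>left_step_w0\<close>,
    \<open>right_step_w0\<close>), so that by \<open>P\<^sub>4\<close> the function \<open>x \<mapsto> \<a>(w\<^sub>0 x)\<close> is monotone where \<open>\<a>\<close> is
    antitone;
  \<^item> the coordinate of \<open>T\<^sub>w\<^sub>0\<close> at \<open>z\<close> is \<open>\<plusminus> \<tau>(C\<^bsub>w0 z\<^esub>)\<close> (\<open>co_T_w0\<close>), of degree at most \<open>-\<a>(w\<^sub>0 z)\<close>
    by \<open>P\<^sub>1\<close>;
  \<^item> \<open>\<lambda>\<^sup>(\<^sup>-\<^sup>n\<^sup>)\<close> at \<open>(x, y)\<close> is, up to sign, \<open>\<lambda>\<^sup>(\<^sup>n\<^sup>)\<close> at \<open>(w\<^sub>0 y, w\<^sub>0 x)\<close> (\<open>co_inv_T_w0_pow\<close>).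

  For \<open>n = 1\<close> write \<open>T\<^sub>w\<^sub>0 C\<^sub>y = \<Sum>\<^sub>z c\<^sub>z C\<^sub>z C\<^sub>y\<close>.  If \<open>C\<^sub>x\<close> occurs in \<open>C\<^sub>z C\<^sub>y\<close> then \<open>x \<le>\<^sub>R z\<close>, hence
  \<open>deg c\<^sub>z \<le> -\<a>(w\<^sub>0 z) \<le> -\<a>(w\<^sub>0 x)\<close>, while \<open>deg h\<^bsub>z,y,x\<^esub> \<le> \<a>(x)\<close>; if equality holds in the latter then
  \<open>\<gamma>\<^bsub>z,y,x^-1\<^esub> \<noteq> 0\<close> and \<open>P\<^sub>8\<close> gives \<open>x \<sim>\<^sub>L y\<close>.  Matrix multiplication gives (a) for all \<open>n \<ge> 0\<close>, and
  the third fact transports (a) to (b).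

  For (c), \<open>\<lambda>\<^sup>(\<^sup>-\<^sup>n\<^sup>)\<close> is the bar conjugate of \<open>\<lambda>\<^sup>(\<^sup>n\<^sup>)\<close>.  Inside a left cell the bounds (a) for \<open>n\<close> and
  (b) for \<open>-n\<close> are negatives of each other, so \<open>\<lambda>\<^sup>(\<^sup>n\<^sup>)\<close> is an integer multiple of a single power of
  \<open>v\<close>.  The integer is found by putting \<open>v = 1\<close>: there the Hecke algebra becomes the group
  ring, and even powers of \<open>T\<^sub>w\<^sub>0\<close> become 1 since \<open>w\<^sub>0\<^sup>2 = 1\<close>.\<close>

section \<open>Degrees, the bar map and specialization at \<open>v = 1\<close> in the group ring\<close>

abbreviation lookup :: "('k \<Rightarrow>\<^sub>0 'c::zero) \<Rightarrow> 'k \<Rightarrow> 'c" where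
  "lookup \<equiv> Poly_Mapping.lookup"

lemma deg_le_iff: "deg a \<le> Fin g \<longleftrightarrow> (\<forall>k\<in>Poly_Mapping.keys a. k \<le> g)"
  by (auto simp: deg_def)

lemma deg_less_iff: "deg a < Fin g \<longleftrightarrow> (\<forall>k\<in>Poly_Mapping.keys a. k < g)"
  by (auto simp: deg_def)

lemma deg_not_Pinf: "deg a \<noteq> Pinf"
  by (simp add: deg_def)

lemma deg_mult_le:
  assumes "deg a \<le> Fin g" "deg b \<le> Fin h"
  shows "deg (a * b) \<le> Fin (g + h)"
  using assms keys_mult[of a b] unfolding deg_le_iff by (fastforce intro: add_mono)

lemma deg_mult_less_left:
  assumes "deg a < Fin g" "deg b \<le> Fin h"
  shows "deg (a * b) < Fin (g + h)"
  using assms keys_mult[of a b] unfolding deg_le_iff deg_less_iff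
  by (fastforce intro: add_less_le_mono)

lemma deg_mult_less_right:
  assumes "deg a \<le> Fin g" "deg b < Fin h"
  shows "deg (a * b) < Fin (g + h)"
  using assms keys_mult[of a b] unfolding deg_le_iff deg_less_iff
  by (fastforce intro: add_le_less_mono)

lemma deg_sum_le:
  assumes "\<And>i. i \<in> I \<Longrightarrow> deg (f i) \<le> Fin g"
  shows "deg (\<Sum>i\<in>I. f i) \<le> Fin g"
  using assms keys_sum[of f I] unfolding deg_le_iff by blast

lemma deg_sum_less:
  assumes "\<And>i. i \<in> I \<Longrightarrow> deg (f i) < Fin g"
  shows "deg (\<Sum>i\<in>I. f i) < Fin g"
  using assms keys_sum[of f I] unfolding deg_less_iff by blast

lemma A_neg_add: "a \<in> A_neg \<Longrightarrow> b \<in> A_neg \<Longrightarrow> a + b \<in> A_neg"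
  using keys_add[of a b] by (auto simp: A_neg_def)

lemma A_neg_zero: "0 \<in> A_neg"
  by (simp add: A_neg_def)

lemma A_neg_mult:
  fixes a b :: "'g::linordered_ab_group_add group_ring"
  assumes "a \<in> A_neg" "b \<in> A_neg"
  shows "a * b \<in> A_neg"
proof -
  have "deg a < Fin 0" "deg b < Fin 0"
    using assms by (auto simp: A_neg_def deg_less_iff)
  then have "deg (a * b) < Fin (0 + 0)"
    by (intro deg_mult_less_left) auto
  then show ?thesis
    by (auto simp: A_neg_def deg_less_iff)
qed

lemma A_neg_uminus: "a \<in> A_neg \<Longrightarrow> - a \<in> A_neg"
  by (auto simp: A_neg_def in_keys_iff)

lemma A_neg_sum: "(\<And>i. i \<in> I \<Longrightarrow> f i \<in> A_neg) \<Longrightarrow> (\<Sum>i\<in>I. f i) \<in> A_neg"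
  by (induction I rule: infinite_finite_induct) (auto intro: A_neg_add A_neg_zero)

lemma A_neg_sign: "a \<in> A_neg \<Longrightarrow> (- 1) ^ k * a \<in> A_neg"
  by (induction k) (auto intro: A_neg_uminus)

text \<open>Additive statements about the group ring need only be checked on multiples of powers of
  \<open>v\<close>; this is how the bar map and the specialization are shown to be multiplicative.\<close>

lemma group_ring_induct [case_names single add]:
  fixes a :: "'g \<Rightarrow>\<^sub>0 int"
  assumes "\<And>k c. P (Poly_Mapping.single k c)" and "\<And>a b. P a \<Longrightarrow> P b \<Longrightarrow> P (a + b)"
  shows "P a"
proof (induction a rule: update_induct)
  case const
  then show ?case using assms(1)[of undefined 0] by simp
next
  case (update f a b)
  have "Poly_Mapping.update a b f = f + Poly_Mapping.single a b"
    using update by (intro poly_mapping_eqI)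
      (auto simp: lookup_update lookup_add lookup_single when_def in_keys_iff)
  then show ?case using assms update by simp
qed

lemma lookup_A_bar: "lookup (A_bar a) k = lookup a (- k)"
  by (simp add: A_bar_def map_key.rep_eq)

lemma A_bar_single: "A_bar (Poly_Mapping.single k c) = Poly_Mapping.single (- k) c"
  by (intro poly_mapping_eqI)
    (auto simp: lookup_A_bar lookup_single when_def minus_equation_iff)

lemma A_bar_add: "A_bar (a + b) = A_bar a + A_bar b"
  by (intro poly_mapping_eqI) (simp add: lookup_A_bar lookup_add)

lemma A_bar_uminus: "A_bar (- a) = - A_bar a"
  by (intro poly_mapping_eqI) (simp add: lookup_A_bar)

lemma A_bar_zero [simp]: "A_bar 0 = 0"
  by (intro poly_mapping_eqI) (simp add: lookup_A_bar)

lemma A_bar_one [simp]: "A_bar 1 = 1"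
  using A_bar_single[of 0 1] by simp

lemma A_bar_mult: "A_bar (a * b) = A_bar a * A_bar b"
proof (induction a rule: group_ring_induct)
  case (single k c)
  show ?case
    by (induction b rule: group_ring_induct)
      (simp_all add: A_bar_single A_bar_add mult_single distrib_left)
qed (simp add: A_bar_add distrib_right)

lemma A_bar_sign: "A_bar ((- 1) ^ k) = (- 1) ^ k"
  by (induction k) (simp_all add: A_bar_mult A_bar_uminus)

lemma keys_A_bar: "k \<in> Poly_Mapping.keys (A_bar a) \<longleftrightarrow> - k \<in> Poly_Mapping.keys a"
  by (simp add: in_keys_iff lookup_A_bar)

lemma A_bar_v_pow: "A_bar (v_pow g) = v_pow (- g)"
  by (simp add: v_pow_def A_bar_single)

text \<open>The support of a bar-invariant element is symmetric about 0.  This is the uniqueness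
  principle behind Kazhdan--Lusztig theory.\<close>

lemma bar_invariant_A_neg_eq_0:
  fixes a :: "'g::linordered_ab_group_add group_ring"
  assumes "A_bar a = a" and "a \<in> A_neg"
  shows "a = 0"
proof (rule ccontr)
  assume "a \<noteq> 0"
  then obtain k where k: "k \<in> Poly_Mapping.keys a" by fastforce
  then have "- k \<in> Poly_Mapping.keys a"
    using keys_A_bar[of "- k" a] assms(1) by simp
  with k assms(2) have "k < 0" "- k < 0" by (auto simp: A_neg_def)
  then show False by simp
qed

text \<open>The ring homomorphism to the integers that sends every \<open>v\<^sup>\<gamma>\<close> to 1.\<close>

definition aug :: "'g group_ring \<Rightarrow> int" where
  "aug a = (\<Sum>k\<in>Poly_Mapping.keys a. lookup a k)"

lemma aug_superset:
  assumes "finite K" "Poly_Mapping.keys a \<subseteq> K"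
  shows "aug a = (\<Sum>k\<in>K. lookup a k)"
  unfolding aug_def by (rule sum.mono_neutral_left) (use assms in \<open>auto simp: in_keys_iff\<close>)

lemma aug_add: "aug (a + b) = aug a + aug b"
proof -
  let ?K = "Poly_Mapping.keys a \<union> Poly_Mapping.keys b"
  have "aug (a + b) = (\<Sum>k\<in>?K. lookup (a + b) k)"
    by (rule aug_superset) (use keys_add[of a b] in auto)
  moreover have "aug a = (\<Sum>k\<in>?K. lookup a k)" "aug b = (\<Sum>k\<in>?K. lookup b k)"
    by (rule aug_superset; simp)+
  ultimately show ?thesis by (simp add: lookup_add sum.distrib)
qed

lemma aug_single [simp]: "aug (Poly_Mapping.single k c) = c"
  by (simp add: aug_def)

lemma aug_zero [simp]: "aug 0 = 0"
  by (simp add: aug_def)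

lemma aug_one [simp]: "aug 1 = 1"
  using aug_single[of 0 1] by simp

lemma aug_v_pow [simp]: "aug (v_pow g) = 1"
  by (simp add: v_pow_def)

lemma aug_uminus: "aug (- a) = - aug a"
  by (simp add: aug_def sum_negf)

lemma aug_diff: "aug (a - b) = aug a - aug b"
  using aug_add[of a "- b"] by (simp add: aug_uminus)

lemma aug_sum: "aug (\<Sum>i\<in>I. f i) = (\<Sum>i\<in>I. aug (f i))"
  by (induction I rule: infinite_finite_induct) (auto simp: aug_add)

lemma aug_mult: "aug (a * b) = aug a * aug b"
proof (induction a rule: group_ring_induct)
  case (single k c)
  show ?case
    by (induction b rule: group_ring_induct)
      (simp_all add: mult_single aug_add distrib_left)
qed (simp add: aug_add distrib_right)

lemma int_mult_add: "int_mult (int (Suc m)) g = g + int_mult (int m) g"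
  by (simp add: int_mult_def nat_add_distrib add.commute del: sum_constant)
   
lemma int_mult_0: "int_mult 0 g = 0"
  by (simp add: int_mult_def)

lemma int_mult_uminus: "int_mult (- n) g = int_mult n (- g)" "int_mult (- n) g = - int_mult n g"
  by (auto simp: int_mult_def sum_negf)

section \<open>Scalar multiplication on the free module\<close>

lemma lookup_scale: "lookup (scale a h) w = a * lookup h w"
  by (simp add: scale_def Poly_Mapping.map.rep_eq when_def)

lemma scale_simps:
  "scale a (h + k) = scale a h + scale a k" "scale (a + b) h = scale a h + scale b h"
  "scale a (scale b h) = scale (a * b) h" "scale 1 h = h" "scale 0 h = 0" "scale a 0 = 0"
  "scale (- a) h = - scale a h" "scale (a - b) h = scale a h - scale b h"
  "scale a (h - k) = scale a h - scale a k" "scale a (- h) = - scale a h"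
  by (intro poly_mapping_eqI; simp add: lookup_scale lookup_add lookup_minus algebra_simps)+

lemma scale_sum: "scale a (\<Sum>i\<in>I. f i) = (\<Sum>i\<in>I. scale a (f i))"
  by (induction I rule: infinite_finite_induct) (auto simp: scale_simps)

lemma lookup_T: "lookup (T w) u = (if w = u then 1 else 0)"
  by (simp add: T_def lookup_single when_def)

section \<open>The length function of a Coxeter system\<close>

lemma word_prod_simps [simp]:
  "word_prod W [] = \<one>\<^bsub>W\<^esub>" "word_prod W (s # ws) = s \<otimes>\<^bsub>W\<^esub> word_prod W ws"
  by (simp_all add: word_prod_def)

context coxeter_system
begin

abbreviation len :: "'w \<Rightarrow> nat" where
  "len \<equiv> cox_length W S"

lemma S_closed [simp, intro]: "s \<in> S \<Longrightarrow> s \<in> carrier W"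
  using gens by blast

lemma S_square: "s \<in> S \<Longrightarrow> s \<otimes> s = \<one>"
  using pow_ord_eq_1[of s] involutions[of s] by (simp add: numeral_2_eq_2)

lemma S_inv: "s \<in> S \<Longrightarrow> inv s = s"
  using S_square by (simp add: inv_equality)

lemma S_cancel: "s \<in> S \<Longrightarrow> w \<in> carrier W \<Longrightarrow> s \<otimes> (s \<otimes> w) = w"
  using S_square by (simp add: m_assoc[symmetric])

lemma S_cancel_right: "s \<in> S \<Longrightarrow> w \<in> carrier W \<Longrightarrow> w \<otimes> s \<otimes> s = w"
  using S_square by (simp add: m_assoc)

lemma word_prod_closed [simp]: "ws \<in> lists S \<Longrightarrow> word_prod W ws \<in> carrier W"
  by (induction ws) auto

lemma word_prod_append:
  "us \<in> lists S \<Longrightarrow> vs \<in> lists S \<Longrightarrow> word_prod W (us @ vs) = word_prod W us \<otimes> word_prod W vs"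
  by (induction us) (auto simp: m_assoc)

lemma word_prod_rev: "ws \<in> lists S \<Longrightarrow> word_prod W (rev ws) = inv (word_prod W ws)"
  by (induction ws) (auto simp: word_prod_append inv_mult_group S_inv in_lists_conv_set)

lemma ex_word: "w \<in> carrier W \<Longrightarrow> \<exists>ws\<in>lists S. word_prod W ws = w"
proof -
  assume "w \<in> carrier W"
  then have "w \<in> generate W S" using gens by simp
  then show ?thesis
  proof (induction rule: generate.induct)
    case one
    then show ?case by (intro bexI[of _ "[]"]) auto
  next
    case (incl h)
    then show ?case by (intro bexI[of _ "[h]"]) auto
  next
    case (inv h)
    then show ?case by (intro bexI[of _ "[h]"]) (auto simp: S_inv)
  next
    case (eng h1 h2)
    then obtain us vs where "us \<in> lists S" "word_prod W us = h1" "vs \<in> lists S" "word_prod W vs = h2"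
      by blast
    then show ?case by (intro bexI[of _ "us @ vs"]) (auto simp: word_prod_append)
  qed
qed

lemma reduced_word:
  assumes "w \<in> carrier W"
  obtains ws where "ws \<in> lists S" "word_prod W ws = w" "length ws = len w"
proof -
  have "\<exists>k. \<exists>ws\<in>lists S. length ws = k \<and> word_prod W ws = w"
    using ex_word[OF assms] by blast
  from LeastI_ex[OF this] show ?thesis
    using that unfolding cox_length_def by blast
qed

lemma len_le: "ws \<in> lists S \<Longrightarrow> len (word_prod W ws) \<le> length ws"
  unfolding cox_length_def by (rule Least_le) blast

lemma len_one [simp]: "len \<one> = 0"
  using len_le[of "[]"] by simp

lemma len_eq_0: "w \<in> carrier W \<Longrightarrow> len w = 0 \<Longrightarrow> w = \<one>"
  by (rule reduced_word[of w]) auto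

lemma len_mult_le: "u \<in> carrier W \<Longrightarrow> w \<in> carrier W \<Longrightarrow> len (u \<otimes> w) \<le> len u + len w"
proof -
  assume u: "u \<in> carrier W" and w: "w \<in> carrier W"
  obtain us where us: "us \<in> lists S" "word_prod W us = u" "length us = len u"
    using reduced_word[OF u] .
  obtain ws where ws: "ws \<in> lists S" "word_prod W ws = w" "length ws = len w"
    using reduced_word[OF w] .
  show ?thesis using len_le[of "us @ ws"] us ws by (simp add: word_prod_append)
qed

lemma len_inv_le: "w \<in> carrier W \<Longrightarrow> len (inv w) \<le> len w"
proof -
  assume w: "w \<in> carrier W"
  obtain ws where ws: "ws \<in> lists S" "word_prod W ws = w" "length ws = len w"
    using reduced_word[OF w] .
  have "rev ws \<in> lists S" using ws(1) by (simp add: in_lists_conv_set)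
  then show ?thesis using len_le[of "rev ws"] ws by (simp add: word_prod_rev)
qed

lemma len_inv [simp]: "w \<in> carrier W \<Longrightarrow> len (inv w) = len w"
  using len_inv_le[of w] len_inv_le[of "inv w"] by simp

lemma len_S_le: "s \<in> S \<Longrightarrow> len s \<le> 1"
  using len_le[of "[s]"] by simp

text \<open>Every relator has even length, so the parity of a word depends only on its value.
  Consequently multiplication by a generator never preserves the length.\<close>

lemma word_parity_one:
  assumes "ws \<in> lists S" "word_prod W ws = \<one>"
  shows "even (length ws)"
proof -
  have "equivclp (insert_relator W S) ws []" using presentation assms by simp
  then have "even (length ws) \<longleftrightarrow> even (length ([] :: 'w list))"
  proof (induction rule: equivclp_induct)
    case base
    then show ?case by simp
  next
    case (step y z)
    have "insert_relator W S us vs \<Longrightarrow> even (length us) \<longleftrightarrow> even (length vs)" for us vs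
      unfolding insert_relator_def
      by (auto simp: length_concat sum_list_replicate)
    then show ?case using step by blast
  qed
  then show ?thesis by simp
qed

lemma word_parity:
  assumes "us \<in> lists S" "vs \<in> lists S" "word_prod W us = word_prod W vs"
  shows "even (length us) \<longleftrightarrow> even (length vs)"
proof -
  have "word_prod W (us @ rev vs) = \<one>"
    using assms by (subst word_prod_append) (auto simp: word_prod_rev in_lists_conv_set)
  moreover have "us @ rev vs \<in> lists S" using assms by auto
  ultimately show ?thesis using word_parity_one[of "us @ rev vs"] by simp
qed

lemma len_S_mult_neq:
  assumes "s \<in> S" "w \<in> carrier W"
  shows "len (s \<otimes> w) \<noteq> len w"
proof -
  obtain ws where ws: "ws \<in> lists S" "word_prod W ws = w" "length ws = len w"
    using reduced_word[OF assms(2)] .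
  obtain us where us: "us \<in> lists S" "word_prod W us = s \<otimes> w" "length us = len (s \<otimes> w)"
    using reduced_word[of "s \<otimes> w"] assms by auto
  have "even (length us) \<longleftrightarrow> even (length (s # ws))"
    using us ws assms by (intro word_parity) auto
  then show ?thesis using us ws by auto
qed

lemma len_S_mult_cases:
  assumes "s \<in> S" "w \<in> carrier W"
  obtains "len (s \<otimes> w) = len w + 1" | "len w = len (s \<otimes> w) + 1"
proof -
  have "len (s \<otimes> w) \<le> len w + 1"
    using len_mult_le[of s w] len_S_le[of s] assms by auto
  moreover have "len w \<le> len (s \<otimes> w) + 1"
    using len_mult_le[of s "s \<otimes> w"] len_S_le[of s] assms by (auto simp: S_cancel)
  ultimately show ?thesis using len_S_mult_neq[OF assms] that by linarith
qed

lemma len_mult_S: "s \<in> S \<Longrightarrow> w \<in> carrier W \<Longrightarrow> len (w \<otimes> s) = len (s \<otimes> inv w)"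
  using len_inv[of "w \<otimes> s"] by (simp add: inv_mult_group S_inv del: len_inv)

lemma len_mult_S_cases:
  assumes "s \<in> S" "w \<in> carrier W"
  obtains "len (w \<otimes> s) = len w + 1" | "len w = len (w \<otimes> s) + 1"
  using len_S_mult_cases[of s "inv w"] assms by (auto simp: len_mult_S)

lemma len_mult_S_disj:
  "s \<in> S \<Longrightarrow> w \<in> carrier W \<Longrightarrow> len (w \<otimes> s) = len w + 1 \<or> len w = len (w \<otimes> s) + 1"
  by (rule len_mult_S_cases[of s w]) auto

lemma len_S: "s \<in> S \<Longrightarrow> len s = 1"
  using len_S_mult_cases[of s \<one>] by auto

lemma left_descent:
  assumes "w \<in> carrier W" "w \<noteq> \<one>"
  obtains s where "s \<in> S" "len w = len (s \<otimes> w) + 1"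
proof -
  obtain ws where ws: "ws \<in> lists S" "word_prod W ws = w" "length ws = len w"
    using reduced_word[OF assms(1)] .
  then obtain s vs where s: "ws = s # vs" using assms by (cases ws) auto
  then have "s \<in> S" "vs \<in> lists S" using ws by auto
  moreover from this have "s \<otimes> w = word_prod W vs"
    using ws(2) unfolding s by (metis S_cancel word_prod_closed word_prod_simps(2))
  moreover from this have "len (s \<otimes> w) < len w"
    using len_le[of vs] s ws by auto
  ultimately have s: "s \<in> S" "len (s \<otimes> w) < len w" by auto
  from s(1) assms(1) show ?thesis
    by (rule len_S_mult_cases) (use that[of s] s in auto)
qed

lemma right_descent:
  assumes "w \<in> carrier W" "w \<noteq> \<one>"
  obtains s where "s \<in> S" "len w = len (w \<otimes> s) + 1"
  using left_descent[of "inv w"] assms by (metis inv_closed inv_eq_1_iff len_inv len_mult_S)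

text \<open>Induction on the length, peeling off one generator on the left of a reduced word.\<close>

lemma len_induct [consumes 1, case_names one step]:
  assumes "w \<in> carrier W" and "P \<one>"
    and "\<And>s u. s \<in> S \<Longrightarrow> u \<in> carrier W \<Longrightarrow> len (s \<otimes> u) = len u + 1 \<Longrightarrow> P u \<Longrightarrow> P (s \<otimes> u)"
  shows "P w"
  using assms(1)
proof (induction "len w" arbitrary: w)
  case 0
  then show ?case using len_eq_0 assms(2) by simp
next
  case (Suc n)
  then have "w \<noteq> \<one>" by auto
  then obtain s where s: "s \<in> S" "len w = len (s \<otimes> w) + 1" using left_descent Suc by blast
  then have "P (s \<otimes> w)" using Suc by auto
  then show ?case using assms(3)[of s "s \<otimes> w"] s Suc(3) by (simp add: S_cancel)
qed

end

section \<open>The standard basis of the Hecke algebra\<close>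

locale finite_hecke = W: coxeter_system W S + hecke_algebra W S L H
  for W :: "('w, 'b) monoid_scheme" and S :: "'w set"
    and L :: "'w \<Rightarrow> 'g::linordered_ab_group_add"
    and H :: "('w, 'g) hecke monoid" (structure) +
  fixes w0 :: 'w
  assumes fin: "finite (carrier W)"
    and L_pos: "s \<in> S \<Longrightarrow> 0 < L s"
    and longest: "longest_element W S w0"
begin

abbreviation mult_W :: "'w \<Rightarrow> 'w \<Rightarrow> 'w"  (infixl "\<bullet>" 70) where
  "u \<bullet> w \<equiv> u \<otimes>\<^bsub>W\<^esub> w"

abbreviation inv_W :: "'w \<Rightarrow> 'w" where
  "inv_W w \<equiv> inv\<^bsub>W\<^esub> w"

definition xi :: "'w \<Rightarrow> 'g group_ring" where
  "xi s = v_pow (L s) - v_pow (- L s)"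

lemma zero_closed [simp]: "0 \<in> carrier H"
  by (simp add: carrier_eq free_module_def)

lemma add_closed [simp]: "h \<in> carrier H \<Longrightarrow> k \<in> carrier H \<Longrightarrow> h + k \<in> carrier H"
  using keys_add[of h k] by (auto simp: carrier_eq free_module_def)

lemma scale_closed [simp]: "h \<in> carrier H \<Longrightarrow> scale a h \<in> carrier H"
  by (auto simp: carrier_eq free_module_def in_keys_iff lookup_scale)

lemma minus_eq_scale: "- h = scale (- 1) h"
  by (simp add: scale_simps)

lemma uminus_closed [simp]: "h \<in> carrier H \<Longrightarrow> - h \<in> carrier H"
  using scale_closed[of h "- 1"] by (simp add: scale_simps)

lemma diff_closed [simp]: "h \<in> carrier H \<Longrightarrow> k \<in> carrier H \<Longrightarrow> h - k \<in> carrier H"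
  using add_closed[of h "- k"] by simp

lemma sum_closed [simp]: "(\<And>i. i \<in> I \<Longrightarrow> f i \<in> carrier H) \<Longrightarrow> (\<Sum>i\<in>I. f i) \<in> carrier H"
  by (induction I rule: infinite_finite_induct) auto

lemma T_closed [simp]: "w \<in> carrier W \<Longrightarrow> T w \<in> carrier H"
  by (simp add: carrier_eq free_module_def T_def)

lemma zero_mult [simp]: "k \<in> carrier H \<Longrightarrow> 0 \<otimes> k = 0" "k \<in> carrier H \<Longrightarrow> k \<otimes> 0 = 0"
  using scale_left[of 0 k 0] scale_right[of k 0 0] by (auto simp: scale_simps)

lemma minus_mult: "h \<in> carrier H \<Longrightarrow> k \<in> carrier H \<Longrightarrow> (- h) \<otimes> k = - (h \<otimes> k)"
  "h \<in> carrier H \<Longrightarrow> k \<in> carrier H \<Longrightarrow> h \<otimes> (- k) = - (h \<otimes> k)"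
  by (simp_all add: minus_eq_scale scale_left scale_right)

lemma diff_mult:
  "h \<in> carrier H \<Longrightarrow> h' \<in> carrier H \<Longrightarrow> k \<in> carrier H \<Longrightarrow> (h - h') \<otimes> k = h \<otimes> k - h' \<otimes> k"
  "h \<in> carrier H \<Longrightarrow> h' \<in> carrier H \<Longrightarrow> k \<in> carrier H \<Longrightarrow> k \<otimes> (h - h') = k \<otimes> h - k \<otimes> h'"
  using distrib_left[of h "- h'" k] distrib_right[of k h "- h'"] by (simp_all add: minus_mult)

lemmas H_simps = distrib_left distrib_right scale_left scale_right minus_mult diff_mult

lemma sum_mult:
  assumes "\<And>i. i \<in> I \<Longrightarrow> f i \<in> carrier H" "k \<in> carrier H"
  shows "(\<Sum>i\<in>I. f i) \<otimes> k = (\<Sum>i\<in>I. f i \<otimes> k)"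
  using assms by (induction I rule: infinite_finite_induct) (auto simp: H_simps)

lemma mult_sum:
  assumes "\<And>i. i \<in> I \<Longrightarrow> f i \<in> carrier H" "k \<in> carrier H"
  shows "k \<otimes> (\<Sum>i\<in>I. f i) = (\<Sum>i\<in>I. k \<otimes> f i)"
  using assms by (induction I rule: infinite_finite_induct) (auto simp: H_simps)

lemma lookup_outside: "h \<in> carrier H \<Longrightarrow> w \<notin> carrier W \<Longrightarrow> lookup h w = 0"
  by (auto simp: carrier_eq free_module_def in_keys_iff)

lemma lookup_scale_T: "lookup (scale a (T w)) u = (if w = u then a else 0)"
  by (simp add: lookup_scale lookup_T)

lemma T_expansion: "h \<in> carrier H \<Longrightarrow> h = (\<Sum>w\<in>carrier W. scale (lookup h w) (T w))"
  by (rule poly_mapping_eqI) (simp add: lookup_sum lookup_scale_T fin lookup_outside)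

text \<open>Linear and semilinear identities in the Hecke algebra need only be checked on the basis
  \<open>(T\<^sub>w)\<close>.\<close>

lemma H_induct [consumes 1, case_names T add scale]:
  assumes "h \<in> carrier H"
    and "\<And>w. w \<in> carrier W \<Longrightarrow> P (T w)"
    and "\<And>h k. h \<in> carrier H \<Longrightarrow> k \<in> carrier H \<Longrightarrow> P h \<Longrightarrow> P k \<Longrightarrow> P (h + k)"
    and "\<And>a h. h \<in> carrier H \<Longrightarrow> P h \<Longrightarrow> P (scale a h)"
  shows "P h"
proof -
  have "P (\<Sum>w\<in>I. scale (lookup h w) (T w))" if "finite I" "I \<subseteq> carrier W" for I
    using that
  proof (induction I rule: finite_induct)
    case empty
    have "P (scale 0 (T \<one>\<^bsub>W\<^esub>))" using assms(2,4) by simp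
    then show ?case by (simp add: scale_simps)
  next
    case (insert w I)
    then show ?case
      using assms(2-4) by (auto intro!: assms(3) sum_closed scale_closed)
  qed
  then show ?thesis using T_expansion[OF assms(1)] fin by (metis subset_refl)
qed

text \<open>By the length-additive product rule \<open>T\<^sub>1\<close> is a left identity, hence the identity.\<close>

lemma T_one: "T \<one>\<^bsub>W\<^esub> = \<one>"
proof -
  have "T \<one>\<^bsub>W\<^esub> \<otimes> h = h" if "h \<in> carrier H" for h
    using that
  proof (induction h rule: H_induct)
    case (T w)
    then show ?case using T_mult[of "\<one>\<^bsub>W\<^esub>" w] by simp
  qed (simp_all add: H_simps)
  from this[of \<one>] show ?thesis by simp
qed

lemma T_left_up:
  assumes "s \<in> S" "w \<in> carrier W" "W.len (s \<bullet> w) = W.len w + 1"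
  shows "T s \<otimes> T w = T (s \<bullet> w)"
  using assms T_mult[of s w] by (simp add: W.len_S)

lemma T_square: "s \<in> S \<Longrightarrow> T s \<otimes> T s = \<one> + scale (xi s) (T s)"
  using T_quadratic by (simp add: xi_def)

lemma T_left_down:
  assumes "s \<in> S" "w \<in> carrier W" "W.len w = W.len (s \<bullet> w) + 1"
  shows "T s \<otimes> T w = T (s \<bullet> w) + scale (xi s) (T w)"
proof -
  have 1: "T s \<otimes> T (s \<bullet> w) = T w"
    using T_left_up[of s "s \<bullet> w"] assms by (simp add: W.S_cancel)
  then have "T s \<otimes> T w = (T s \<otimes> T s) \<otimes> T (s \<bullet> w)"
    using assms by (simp add: m_assoc)
  also have "\<dots> = T (s \<bullet> w) + scale (xi s) (T w)"
    using assms by (simp add: T_square H_simps 1)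
  finally show ?thesis .
qed

lemma T_right_up:
  assumes "s \<in> S" "w \<in> carrier W" "W.len (w \<bullet> s) = W.len w + 1"
  shows "T w \<otimes> T s = T (w \<bullet> s)"
  using assms T_mult[of w s] by (simp add: W.len_S)

lemma T_right_down:
  assumes "s \<in> S" "w \<in> carrier W" "W.len w = W.len (w \<bullet> s) + 1"
  shows "T w \<otimes> T s = T (w \<bullet> s) + scale (xi s) (T w)"
proof -
  have 1: "T (w \<bullet> s) \<otimes> T s = T w"
    using T_right_up[of s "w \<bullet> s"] assms by (simp add: W.S_cancel_right)
  then have "T w \<otimes> T s = T (w \<bullet> s) \<otimes> (T s \<otimes> T s)"
    using assms by (simp add: m_assoc[symmetric])
  also have "\<dots> = T (w \<bullet> s) + scale (xi s) (T w)"
    using assms by (simp add: T_square H_simps 1)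
  finally show ?thesis .
qed

section \<open>The exchange condition and the longest element\<close>

lemma xi_nonzero: "s \<in> S \<Longrightarrow> xi s \<noteq> 0"
proof
  assume s: "s \<in> S" and "xi s = 0"
  then have "lookup (xi s) (L s) = 0" by simp
  then show False
    using L_pos[OF s] by (auto simp: xi_def v_pow_def lookup_minus lookup_single when_def split: if_splits)
qed

text \<open>Associativity of the product \<open>T\<^sub>s T\<^sub>w T\<^sub>t\<close> gives
  \<open>\<xi>\<^sub>t T\<^sub>s\<^sub>w = \<xi>\<^sub>s T\<^sub>w\<^sub>t\<close>.  So the existence of the Hecke algebra,
  with nonzero parameters, forces the folding condition, from which the exchange
  condition follows.\<close>

lemma folding:
  assumes s: "s \<in> S" and t: "t \<in> S" and w: "w \<in> carrier W"
    and "W.len (s \<bullet> w) = W.len w + 1" "W.len (w \<bullet> t) = W.len w + 1"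
    and "W.len (s \<bullet> w \<bullet> t) = W.len w"
  shows "s \<bullet> w = w \<bullet> t"
proof -
  have "T s \<otimes> T w \<otimes> T t = T (s \<bullet> w \<bullet> t) + scale (xi t) (T (s \<bullet> w))"
    using T_left_up[of s w] T_right_down[of t "s \<bullet> w"] assms by simp
  moreover have "T s \<otimes> (T w \<otimes> T t) = T (s \<bullet> w \<bullet> t) + scale (xi s) (T (w \<bullet> t))"
    using T_right_up[of t w] T_left_down[of s "w \<bullet> t"] assms by (simp add: W.m_assoc)
  ultimately have "scale (xi t) (T (s \<bullet> w)) = scale (xi s) (T (w \<bullet> t))"
    using assms by (simp add: m_assoc)
  then have "lookup (scale (xi t) (T (s \<bullet> w))) (s \<bullet> w) = lookup (scale (xi s) (T (w \<bullet> t))) (s \<bullet> w)"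
    by simp
  then show ?thesis
    using xi_nonzero[OF t] by (auto simp: lookup_scale lookup_T split: if_splits)
qed

text \<open>Exchange condition in a form without words.  The letters of \<open>a\<close> are put in front of \<open>b\<close>
  one at a time; the first one after which \<open>s\<close> becomes a right descent is, by folding, the letter
  that multiplication by \<open>s\<close> deletes.\<close>

lemma exchange:
  assumes "a \<in> carrier W" "b \<in> carrier W" "s \<in> S"
    and "W.len (a \<bullet> b) = W.len a + W.len b"
    and "W.len (b \<bullet> s) = W.len b + 1" and "W.len (a \<bullet> b \<bullet> s) < W.len (a \<bullet> b)"
  shows "\<exists>a'\<in>carrier W. a \<bullet> b \<bullet> s = a' \<bullet> b \<and> W.len a' < W.len a"
  using assms(1,4,6)
proof (induction a rule: W.len_induct)
  case one
  then show ?case using assms by simp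
next
  case (step t u)
  note S = \<open>t \<in> S\<close> \<open>s \<in> S\<close> and C = \<open>u \<in> carrier W\<close> \<open>b \<in> carrier W\<close>
  have assoc: "t \<bullet> u \<bullet> b = t \<bullet> (u \<bullet> b)" "t \<bullet> u \<bullet> b \<bullet> s = t \<bullet> (u \<bullet> b \<bullet> s)"
    using S C by (simp_all add: W.m_assoc)
  have le: "W.len (u \<bullet> b) \<le> W.len u + W.len b" "W.len (t \<bullet> (u \<bullet> b)) \<le> 1 + W.len (u \<bullet> b)"
    using W.len_mult_le C W.len_mult_le[of t "u \<bullet> b"] S by (auto simp: W.len_S)
  then have add: "W.len (u \<bullet> b) = W.len u + W.len b" "W.len (t \<bullet> (u \<bullet> b)) = W.len (u \<bullet> b) + 1"
    using step assoc by auto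
  show ?case
  proof (cases "W.len (u \<bullet> b \<bullet> s) < W.len (u \<bullet> b)")
    case True
    then obtain a' where a': "a' \<in> carrier W" "u \<bullet> b \<bullet> s = a' \<bullet> b" "W.len a' < W.len u"
      using step add by blast
    have "W.len (t \<bullet> a') < W.len (t \<bullet> u)"
      using W.len_mult_le[of t a'] W.len_S[of t] a' step by auto
    then show ?thesis
      using a' S C assoc by (intro bexI[of _ "t \<bullet> a'"]) (auto simp: W.m_assoc)
  next
    case False
    then have up: "W.len (u \<bullet> b \<bullet> s) = W.len (u \<bullet> b) + 1"
      using W.len_mult_S_disj[of s "u \<bullet> b"] S C by simp
    have "W.len (t \<bullet> (u \<bullet> b) \<bullet> s) = W.len (u \<bullet> b)"
      using W.len_mult_S_disj[of s "t \<bullet> (u \<bullet> b)"] step.prems(2) add assoc S C by (simp add: W.m_assoc)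
    then have "t \<bullet> (u \<bullet> b) = u \<bullet> b \<bullet> s"
      using folding[of t s "u \<bullet> b"] up add S C by simp
    then have "t \<bullet> u \<bullet> b \<bullet> s = u \<bullet> b"
      using assoc S C by (simp add: W.S_cancel W.S_cancel_right)
    then show ?thesis using C step by (intro bexI[of _ u]) auto
  qed
qed

lemma w0_closed [simp]: "w0 \<in> carrier W"
  using longest by (simp add: longest_element_def is_arg_max_def)

lemma len_le_w0: "w \<in> carrier W \<Longrightarrow> W.len w \<le> W.len w0"
  using longest by (auto simp: longest_element_def is_arg_max_def not_less)

text \<open>Induction on the length, appending the letters of \<open>w\<close> on the right.  If \<open>w\<^sub>0 = u v\<close> and
  \<open>v s\<close> is longer than \<open>v\<close>, then \<open>s\<close> is a right descent of \<open>w\<^sub>0\<close> because \<open>w\<^sub>0\<close> is longest, and the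
  exchange condition deletes a letter of \<open>u\<close>.\<close>

lemma w0_right_factor:
  assumes "w \<in> carrier W"
  shows "\<exists>u\<in>carrier W. u \<bullet> w = w0 \<and> W.len w0 = W.len u + W.len w"
  using assms
proof (induction "W.len w" arbitrary: w)
  case 0
  then have "w = \<one>\<^bsub>W\<^esub>" using W.len_eq_0 by simp
  then show ?case by (intro bexI[of _ w0]) auto
next
  case (Suc n)
  then have "w \<noteq> \<one>\<^bsub>W\<^esub>" by auto
  then obtain s where s: "s \<in> S" "W.len w = W.len (w \<bullet> s) + 1"
    using W.right_descent Suc.prems by blast
  define v where "v = w \<bullet> s"
  have v: "v \<in> carrier W" "v \<bullet> s = w" "W.len w = W.len v + 1"
    using s Suc.prems by (auto simp: v_def W.S_cancel_right)
  have "n = W.len v" using Suc.hyps v by simp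
  then obtain u where u: "u \<in> carrier W" "u \<bullet> v = w0" "W.len w0 = W.len u + W.len v"
    using Suc.hyps(1)[of v] v by blast
  have "W.len (u \<bullet> v \<bullet> s) < W.len (u \<bullet> v)"
    using W.len_mult_S_disj[of s w0] len_le_w0[of "w0 \<bullet> s"] s u by simp
  then obtain u' where u': "u' \<in> carrier W" "u \<bullet> v \<bullet> s = u' \<bullet> v" "W.len u' < W.len u"
    using exchange[of u v s] u v s by auto
  have "u' \<bullet> w = w0 \<bullet> s \<bullet> s"
    using u u' v s by (metis W.m_assoc W.S_closed)
  then have eq: "u' \<bullet> w = w0" using s by (simp add: W.S_cancel_right)
  moreover have "W.len w0 \<le> W.len u' + W.len w"
    using W.len_mult_le[of u' w] eq u' Suc.prems by simp
  ultimately show ?case using u u' v by (intro bexI[of _ u']) auto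
qed

text \<open>As the complementary factor of \<open>w\<close> in \<open>w\<^sub>0\<close> is determined by \<open>w\<close>, the existence
  statement becomes a formula; with \<open>w = w\<^sub>0\<^sup>-\<^sup>1\<close> it yields \<open>w\<^sub>0\<^sup>2 = 1\<close>.\<close>

lemma len_w0_mult_inv:
  assumes "w \<in> carrier W"
  shows "W.len w0 = W.len (w0 \<bullet> inv_W w) + W.len w"
proof -
  obtain u where u: "u \<in> carrier W" "u \<bullet> w = w0" "W.len w0 = W.len u + W.len w"
    using w0_right_factor[OF assms] by blast
  then have "w0 \<bullet> inv_W w = u" using assms by (metis W.inv_solve_right w0_closed)
  then show ?thesis using u by simp
qed

lemma w0_square: "w0 \<bullet> w0 = \<one>\<^bsub>W\<^esub>"
  using len_w0_mult_inv[of "inv_W w0"] by (intro W.len_eq_0) auto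

lemma w0_inv: "inv_W w0 = w0"
  using w0_square by (simp add: W.inv_equality)

lemma w0_cancel: "w \<in> carrier W \<Longrightarrow> w0 \<bullet> (w0 \<bullet> w) = w"
  using w0_square by (simp add: W.m_assoc[symmetric])

lemma len_w0_left: "w \<in> carrier W \<Longrightarrow> W.len w0 = W.len (w0 \<bullet> w) + W.len w"
  using len_w0_mult_inv[of "inv_W w"] by simp

lemma len_w0_right: "w \<in> carrier W \<Longrightarrow> W.len w0 = W.len w + W.len (w \<bullet> w0)"
  using len_w0_left[of "inv_W w"] W.len_inv[of "w \<bullet> w0"] W.len_inv[of w]
  by (simp add: W.inv_mult_group w0_inv del: W.len_inv)

lemma T_w0_right: "w \<in> carrier W \<Longrightarrow> T (inv_W w) \<otimes> T (w \<bullet> w0) = T w0"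
  using T_mult[of "inv_W w" "w \<bullet> w0"] len_w0_right[of w] by (simp add: W.m_assoc[symmetric])

section \<open>Inverses of standard basis elements and the trace form\<close>

text \<open>The quadratic relation says \<open>T\<^sub>s (T\<^sub>s - \<xi>\<^sub>s) = 1\<close>.\<close>

lemma T_S_unit: "s \<in> S \<Longrightarrow> T s \<in> Units H" and inv_T_S: "s \<in> S \<Longrightarrow> inv (T s) = T s - scale (xi s) \<one>"
proof -
  assume s: "s \<in> S"
  let ?i = "T s - scale (xi s) \<one>"
  have *: "?i \<otimes> T s = \<one>" "T s \<otimes> ?i = \<one>" "?i \<in> carrier H"
    using s by (simp_all add: H_simps T_square)
  then show "T s \<in> Units H" using s by (auto simp: Units_def)
  show "inv (T s) = ?i" using * s by (intro inv_char) auto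
qed

lemma T_unit [simp]: "w \<in> carrier W \<Longrightarrow> T w \<in> Units H"
proof (induction w rule: W.len_induct)
  case one
  then show ?case by (simp add: T_one)
next
  case (step s u)
  then show ?case using T_left_up[of s u] T_S_unit[of s] Units_m_closed[of "T s" "T u"] by simp
qed

lemma inv_mult_Units:
  assumes "x \<in> Units H" "y \<in> Units H"
  shows "inv (x \<otimes> y) = inv y \<otimes> inv x"
proof (rule inv_char)
  show "x \<otimes> y \<otimes> (inv y \<otimes> inv x) = \<one>" "inv y \<otimes> inv x \<otimes> (x \<otimes> y) = \<one>"
    using assms m_assoc[of x y "inv y \<otimes> inv x"] m_assoc[of y "inv y" "inv x"]
      m_assoc[of "inv y" "inv x" "x \<otimes> y"] m_assoc[of "inv x" x y]
    by (simp_all add: Units_closed)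
qed (use assms in \<open>auto simp: Units_closed\<close>)

lemma inv_T_step:
  assumes "s \<in> S" "w \<in> carrier W" "W.len (s \<bullet> w) = W.len w + 1"
  shows "inv (T (s \<bullet> w)) = inv (T w) \<otimes> inv (T s)"
  using T_left_up[OF assms] inv_mult_Units[of "T s" "T w"] assms by simp

lemma inv_T_S_square: "s \<in> S \<Longrightarrow> inv (T s) \<otimes> inv (T s) = \<one> - scale (xi s) (inv (T s))"
  by (simp add: inv_T_S H_simps T_square scale_simps algebra_simps)

lemma inv_T_cancel:
  assumes "w \<in> carrier W" "h \<in> carrier H"
  shows "inv (T w) \<otimes> (T w \<otimes> h) = h" "T w \<otimes> (inv (T w) \<otimes> h) = h"
    "h \<otimes> T w \<otimes> inv (T w) = h" "h \<otimes> inv (T w) \<otimes> T w = h"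
  using assms m_assoc[of "inv (T w)" "T w" h] m_assoc[of "T w" "inv (T w)" h]
    m_assoc[of h "T w" "inv (T w)"] m_assoc[of h "inv (T w)" "T w"] by simp_all

lemma inv_T_w0:
  assumes "w \<in> carrier W"
  shows "inv (T w) \<otimes> T w0 = T (inv_W w \<bullet> w0)"
proof -
  have "T w0 = T w \<otimes> T (inv_W w \<bullet> w0)"
    using T_w0_right[of "inv_W w"] assms by simp
  then show ?thesis using assms by (simp add: inv_T_cancel)
qed

abbreviation tr :: "('w, 'g) hecke \<Rightarrow> 'g group_ring" where
  "tr \<equiv> tau W"

lemma tr_simps: "tr (h + k) = tr h + tr k" "tr (scale a h) = a * tr h"
  "tr (T w) = (if w = \<one>\<^bsub>W\<^esub> then 1 else 0)"
  by (simp_all add: tau_def lookup_add lookup_scale lookup_T)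

lemma tr_sum: "tr (\<Sum>i\<in>I. f i) = (\<Sum>i\<in>I. tr (f i))"
  by (simp add: tau_def lookup_sum)

text \<open>The basis \<open>(T\<^sub>w)\<close> is dual to \<open>(T\<^bsub>w^-1\<^esub>)\<close> for the form \<open>\<tau>(h k)\<close>.  Moving the last letter
  \<open>s\<close> of \<open>u\<close> over to \<open>w\<close> produces, when \<open>s\<close> is a left descent of \<open>w\<close>, an extra multiple of
  \<open>\<tau>(T\<^bsub>us\<^esub> T\<^sub>w)\<close>, which vanishes for reasons of length.\<close>

lemma tr_T_mult:
  assumes "u \<in> carrier W" "w \<in> carrier W"
  shows "tr (T u \<otimes> T w) = (if u \<bullet> w = \<one>\<^bsub>W\<^esub> then 1 else 0)"
  using assms
proof (induction "W.len u" arbitrary: u w)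
  case 0
  then have "u = \<one>\<^bsub>W\<^esub>" using W.len_eq_0 by simp
  then show ?case using 0 by (simp add: T_one tr_simps)
next
  case (Suc n)
  then have "u \<noteq> \<one>\<^bsub>W\<^esub>" by auto
  then obtain s where s: "s \<in> S" "W.len u = W.len (u \<bullet> s) + 1"
    using W.right_descent Suc.prems by blast
  define v where "v = u \<bullet> s"
  have v: "v \<in> carrier W" "v \<bullet> s = u" "W.len u = W.len v + 1"
    using s Suc.prems by (auto simp: v_def W.S_cancel_right)
  have IH: "tr (T v \<otimes> T x) = (if v \<bullet> x = \<one>\<^bsub>W\<^esub> then 1 else 0)" if "x \<in> carrier W" for x
    using Suc.hyps v that by simp
  have eq: "v \<bullet> (s \<bullet> w) = u \<bullet> w" using v s Suc.prems by (metis W.m_assoc W.S_closed)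
  have Tu: "T u \<otimes> T w = T v \<otimes> (T s \<otimes> T w)"
    using T_right_up[of s v] v s Suc.prems by (simp add: m_assoc[symmetric])
  from s(1) Suc.prems(2) show ?case
  proof (cases rule: W.len_S_mult_cases)
    case 1
    then show ?thesis using T_left_up[of s w] Tu IH[of "s \<bullet> w"] eq s Suc.prems by simp
  next
    case 2
    have "v \<bullet> w \<noteq> \<one>\<^bsub>W\<^esub>"
    proof
      assume "v \<bullet> w = \<one>\<^bsub>W\<^esub>"
      then have w: "w = inv_W v" using v Suc.prems by (metis W.inv_equality W.inv_inv)
      then have "s \<bullet> w = inv_W u" using v s by (metis W.S_closed W.S_inv W.inv_mult_group)
      then have "W.len (s \<bullet> w) = W.len w + 1" using v w Suc.prems by simp
      with 2 show False by simp
    qed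
    then show ?thesis
      using T_left_down[of s w] Tu IH[of "s \<bullet> w"] IH[of w] eq s v 2 Suc.prems
      by (simp add: H_simps tr_simps)
  qed
qed

lemma tr_commute: "h \<in> carrier H \<Longrightarrow> k \<in> carrier H \<Longrightarrow> tr (h \<otimes> k) = tr (k \<otimes> h)"
proof (induction h rule: H_induct)
  case (T u)
  from T(2,1) show ?case
  proof (induction k rule: H_induct)
    case (T w)
    have "u \<bullet> w = \<one>\<^bsub>W\<^esub> \<longleftrightarrow> w \<bullet> u = \<one>\<^bsub>W\<^esub>"
      using T W.inv_comm by blast
    then show ?case using T by (simp add: tr_T_mult)
  qed (simp_all add: H_simps tr_simps)
qed (simp_all add: H_simps tr_simps)

section \<open>The bar involution and the sign anti-automorphism\<close>

abbreviation bar :: "('w, 'g) hecke \<Rightarrow> ('w, 'g) hecke" where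
  "bar \<equiv> hecke_bar W H"

abbreviation sign :: "'w \<Rightarrow> 'g group_ring" where
  "sign w \<equiv> (- 1) ^ W.len w"

text \<open>On generators \<open>\<sigma>\<close> is \<open>T\<^sub>s \<mapsto> -T\<^sub>s\<^sup>-\<^sup>1\<close>: the composition of the sign automorphism
  of the Hecke algebra with the anti-automorphism \<open>T\<^sub>w \<mapsto> T\<^bsub>w^-1\<^esub>\<close>.\<close>

definition sigma :: "('w, 'g) hecke \<Rightarrow> ('w, 'g) hecke" where
  "sigma h = (\<Sum>w\<in>carrier W. scale (lookup h w * sign w) (inv (T w)))"

lemma sign_square [simp]: "sign w * sign w = 1" "sign w * (sign w * a) = a"
  by (simp_all add: power_mult_distrib[symmetric] mult.assoc[symmetric])

text \<open>A semilinear map that respects products with a generator on the left respects all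
  products, by induction on the length of the left factor.  The operation \<open>m\<close> stands for the
  product or the opposite product, so that one argument serves the bar involution and the
  anti-automorphism \<open>\<sigma>\<close>.\<close>

lemma semilinear_mult_extension:
  assumes cl: "\<And>h. h \<in> carrier H \<Longrightarrow> F h \<in> carrier H"
    and add: "\<And>h k. h \<in> carrier H \<Longrightarrow> k \<in> carrier H \<Longrightarrow> F (h + k) = F h + F k"
    and sc: "\<And>a h. h \<in> carrier H \<Longrightarrow> F (scale a h) = scale (\<alpha> a) (F h)"
    and m: "m = (\<lambda>h k. h \<otimes> k) \<or> m = (\<lambda>h k. k \<otimes> h)"
    and one: "F \<one> = \<one>"
    and gen: "\<And>s w. s \<in> S \<Longrightarrow> w \<in> carrier W \<Longrightarrow> F (T s \<otimes> T w) = m (F (T s)) (F (T w))"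
    and hk: "h \<in> carrier H" "k \<in> carrier H"
  shows "F (h \<otimes> k) = m (F h) (F k)"
proof -
  have m_add: "m (x + y) z = m x z + m y z" "m z (x + y) = m z x + m z y"
    and m_scale: "m (scale a x) z = scale a (m x z)" "m z (scale a x) = scale a (m z x)"
    and m_ass: "m (m x y) z = m x (m y z)"
    if "x \<in> carrier H" "y \<in> carrier H" "z \<in> carrier H" for x y z a
    using m that by (auto simp: H_simps m_assoc)
  have m_one: "m \<one> x = x" if "x \<in> carrier H" for x using m that by auto
  have Ts: "F (T s \<otimes> x) = m (F (T s)) (F x)" if "s \<in> S" "x \<in> carrier H" for s x
    using that(2,1)
    by (induction x rule: H_induct) (simp_all add: gen H_simps add sc cl m_add m_scale)
  have Tw: "F (T w \<otimes> x) = m (F (T w)) (F x)" if "w \<in> carrier W" "x \<in> carrier H" for w x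
    using that
  proof (induction w arbitrary: x rule: W.len_induct)
    case one
    then show ?case by (simp add: T_one assms(5) m_one cl)
  next
    case (step s u)
    have "F (T (s \<bullet> u) \<otimes> x) = F (T s \<otimes> (T u \<otimes> x))"
      using step by (simp add: T_left_up[symmetric] m_assoc)
    also have "\<dots> = m (m (F (T s)) (F (T u))) (F x)"
      using step by (simp add: Ts m_ass cl)
    also have "m (F (T s)) (F (T u)) = F (T (s \<bullet> u))"
      using step by (simp add: T_left_up[symmetric] Ts)
    finally show ?case .
  qed
  from hk show ?thesis
    by (induction h rule: H_induct) (simp_all add: Tw H_simps add sc cl m_add m_scale)
qed

lemma bar_closed [simp]: "bar h \<in> carrier H"
  by (simp add: hecke_bar_def)

lemma bar_T: "w \<in> carrier W \<Longrightarrow> bar (T w) = inv (T (inv_W w))"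
proof -
  assume w: "w \<in> carrier W"
  have "scale (A_bar (lookup (T w) u)) x = (if u = w then x else 0)" for u and x :: "('w, 'g) hecke"
    by (simp add: lookup_T scale_simps)
  then show ?thesis using w fin by (simp add: hecke_bar_def)
qed

lemma bar_add: "bar (h + k) = bar h + bar k"
  by (simp add: hecke_bar_def lookup_add A_bar_add scale_simps sum.distrib)

lemma bar_scale: "bar (scale a h) = scale (A_bar a) (bar h)"
  by (simp add: hecke_bar_def lookup_scale A_bar_mult scale_simps scale_sum)

lemma bar_one: "bar \<one> = \<one>"
  using bar_T[of "\<one>\<^bsub>W\<^esub>"] by (simp add: T_one)

lemma A_bar_xi: "A_bar (xi s) = - xi s"
  using A_bar_add[of "v_pow (L s)" "- v_pow (- L s)"]
  by (simp add: xi_def A_bar_uminus A_bar_v_pow)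

lemma T_inv_step:
  assumes "s \<in> S" "u \<in> carrier W" "W.len (s \<bullet> u) = W.len u + 1"
  shows "T (inv_W u \<bullet> s) = T (inv_W u) \<otimes> T s"
  using T_right_up[of s "inv_W u"] W.len_mult_S[of s "inv_W u"] assms by simp

text \<open>For a left descent \<open>s\<close> of \<open>w\<close> both sides are compared through \<open>T\<^sub>s\<^sup>-\<^sup>2 = 1 - \<xi>\<^sub>s T\<^sub>s\<^sup>-\<^sup>1\<close>,
  which is the image of the quadratic relation because the bar map negates \<open>\<xi>\<^sub>s\<close>.\<close>

lemma bar_mult: "h \<in> carrier H \<Longrightarrow> k \<in> carrier H \<Longrightarrow> bar (h \<otimes> k) = bar h \<otimes> bar k"
proof (rule semilinear_mult_extension[where \<alpha> = A_bar and m = "\<lambda>h k. h \<otimes> k"])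
  fix s w assume s: "s \<in> S" and w: "w \<in> carrier W"
  have up: "bar (T (s \<bullet> u)) = bar (T s) \<otimes> bar (T u)"
    if "u \<in> carrier W" "W.len (s \<bullet> u) = W.len u + 1" for u
  proof -
    have "T (inv_W u) \<otimes> T s = T (inv_W u \<bullet> s)"
      using T_inv_step[OF s that] by simp
    then show ?thesis
      using that s inv_mult_Units[of "T (inv_W u)" "T s"]
      by (simp add: bar_T W.inv_mult_group W.S_inv)
  qed
  from s w show "bar (T s \<otimes> T w) = bar (T s) \<otimes> bar (T w)"
  proof (cases rule: W.len_S_mult_cases)
    case 1
    then show ?thesis using up s w by (simp add: T_left_up)
  next
    case 2
    define u where "u = s \<bullet> w"
    have u: "u \<in> carrier W" "w = s \<bullet> u" "W.len (s \<bullet> u) = W.len u + 1"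
      using s w 2 by (auto simp: u_def W.S_cancel)
    have "bar (T s) \<otimes> bar (T w) = (inv (T s) \<otimes> inv (T s)) \<otimes> bar (T u)"
      using up[OF u(1,3)] u(1) s unfolding u(2) by (simp add: m_assoc bar_T W.S_inv)
    also have "\<dots> = bar (T u) - scale (xi s) (bar (T w))"
      using up[OF u(1,3)] u(1) s unfolding u(2)
      by (simp add: inv_T_S_square H_simps bar_T W.S_inv)
    also have "\<dots> = bar (T s \<otimes> T w)"
      using T_left_down[OF s w 2] by (simp add: bar_add bar_scale A_bar_xi scale_simps u_def)
    finally show ?thesis by simp
  qed
qed (auto simp: bar_add bar_scale bar_one)

lemma sigma_closed [simp]: "sigma h \<in> carrier H"
  by (simp add: sigma_def)

lemma sigma_T: "w \<in> carrier W \<Longrightarrow> sigma (T w) = scale (sign w) (inv (T w))"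
proof -
  assume w: "w \<in> carrier W"
  have "scale (lookup (T w) u * sign u) (inv (T u)) = (if u = w then scale (sign w) (inv (T w)) else 0)" for u
    by (simp add: lookup_T scale_simps)
  then show ?thesis using w fin by (simp add: sigma_def)
qed

lemma sigma_add: "sigma (h + k) = sigma h + sigma k"
  by (simp add: sigma_def lookup_add scale_simps sum.distrib ring_distribs)

lemma sigma_scale: "sigma (scale a h) = scale a (sigma h)"
  by (simp add: sigma_def lookup_scale scale_simps scale_sum mult.assoc)

lemma sigma_one: "sigma \<one> = \<one>"
  using sigma_T[of "\<one>\<^bsub>W\<^esub>"] by (simp add: T_one scale_simps)

lemma sigma_mult: "h \<in> carrier H \<Longrightarrow> k \<in> carrier H \<Longrightarrow> sigma (h \<otimes> k) = sigma k \<otimes> sigma h"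
proof (rule semilinear_mult_extension[where \<alpha> = "\<lambda>a. a" and m = "\<lambda>h k. k \<otimes> h"])
  fix s w assume s: "s \<in> S" and w: "w \<in> carrier W"
  have up: "sigma (T (s \<bullet> u)) = sigma (T u) \<otimes> sigma (T s)"
    if "u \<in> carrier W" "W.len (s \<bullet> u) = W.len u + 1" for u
    using that s inv_T_step[of s u]
    by (simp add: sigma_T H_simps W.len_S scale_simps)
  from s w show "sigma (T s \<otimes> T w) = sigma (T w) \<otimes> sigma (T s)"
  proof (cases rule: W.len_S_mult_cases)
    case 1
    then show ?thesis using up s w by (simp add: T_left_up)
  next
    case 2
    define u where "u = s \<bullet> w"
    have u: "u \<in> carrier W" "w = s \<bullet> u" "W.len (s \<bullet> u) = W.len u + 1"
      using s w 2 by (auto simp: u_def W.S_cancel)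
    have "sigma (T w) \<otimes> sigma (T s) = sigma (T u) \<otimes> (inv (T s) \<otimes> inv (T s))"
      using up[OF u(1,3)] u(1) s unfolding u(2)
      by (simp add: m_assoc sigma_T[of s] W.len_S H_simps scale_simps)
    also have "\<dots> = sigma (T u) + scale (xi s) (sigma (T w))"
      using up[OF u(1,3)] u(1) s unfolding u(2)
      by (simp add: inv_T_S_square H_simps sigma_T[of s] W.len_S scale_simps)
    also have "\<dots> = sigma (T s \<otimes> T w)"
      using T_left_down[OF s w 2] by (simp add: sigma_add sigma_scale u_def)
    finally show ?thesis by simp
  qed
qed (auto simp: sigma_add sigma_scale sigma_one)

lemma inv_image_unit:
  assumes "x \<in> Units H"
  shows "sigma (inv x) = inv (sigma x)" "bar (inv x) = inv (bar x)"
    "sigma x \<in> Units H" "bar x \<in> Units H"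
proof -
  have s: "sigma x \<otimes> sigma (inv x) = \<one>" "sigma (inv x) \<otimes> sigma x = \<one>"
    using assms by (simp_all add: sigma_mult[symmetric] Units_closed sigma_one)
  have b: "bar x \<otimes> bar (inv x) = \<one>" "bar (inv x) \<otimes> bar x = \<one>"
    using assms by (simp_all add: bar_mult[symmetric] Units_closed bar_one)
  show "sigma (inv x) = inv (sigma x)" "bar (inv x) = inv (bar x)"
    using s b by (metis inv_char sigma_closed bar_closed)+
  show "sigma x \<in> Units H" "bar x \<in> Units H"
    using s b unfolding Units_def by (blast intro: sigma_closed bar_closed)+
qed

lemma inv_scale_sign:
  assumes "x \<in> Units H"
  shows "inv (scale (sign w) x) = scale (sign w) (inv x)"
  using assms by (intro inv_char) (auto simp: Units_closed H_simps scale_simps)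

lemma sigma_inv_T: "w \<in> carrier W \<Longrightarrow> sigma (inv (T w)) = scale (sign w) (T w)"
  by (simp add: inv_image_unit sigma_T inv_scale_sign)

lemma sigma_sigma: "h \<in> carrier H \<Longrightarrow> sigma (sigma h) = h"
proof (induction h rule: H_induct)
  case (T w)
  then show ?case by (simp add: sigma_T sigma_scale sigma_inv_T scale_simps)
qed (simp_all add: sigma_add sigma_scale)

lemma bar_sigma: "h \<in> carrier H \<Longrightarrow> bar (sigma h) = sigma (bar h)"
proof (induction h rule: H_induct)
  case (T w)
  then show ?case
    by (simp add: sigma_T bar_T bar_scale A_bar_sign sigma_inv_T inv_image_unit(2))
qed (simp_all add: sigma_add sigma_scale bar_add bar_scale)

section \<open>The linear form \<open>h \<mapsto> \<tau>(h T\<^sub>w\<^sub>0)\<close>\<close>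

definition phi :: "('w, 'g) hecke \<Rightarrow> 'g group_ring" where
  "phi h = tr (h \<otimes> T w0)"

lemma phi_add: "h \<in> carrier H \<Longrightarrow> k \<in> carrier H \<Longrightarrow> phi (h + k) = phi h + phi k"
  by (simp add: phi_def H_simps tr_simps)

lemma phi_scale: "h \<in> carrier H \<Longrightarrow> phi (scale a h) = a * phi h"
  by (simp add: phi_def H_simps tr_simps)

lemma phi_sum: "(\<And>i. i \<in> I \<Longrightarrow> f i \<in> carrier H) \<Longrightarrow> phi (\<Sum>i\<in>I. f i) = (\<Sum>i\<in>I. phi (f i))"
  by (simp add: phi_def sum_mult tr_sum)

lemma mult_w0_eq_one: "w \<in> carrier W \<Longrightarrow> w \<bullet> w0 = \<one>\<^bsub>W\<^esub> \<longleftrightarrow> w = w0"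
  using w0_inv w0_square W.inv_equality[of w w0] by auto

text \<open>Since \<open>T\<^sub>w\<^sup>-\<^sup>1 T\<^sub>w\<^sub>0 = T\<^bsub>w^-1 w0\<^esub>\<close>, the form \<open>\<phi>\<close> takes the same values, 0 or 1, on \<open>T\<^sub>w\<close> and on
  \<open>T\<^sub>w\<^sup>-\<^sup>1\<close>.  Its compatibility with the bar involution and with \<open>\<sigma>\<close> follows at once.\<close>

lemma phi_T: "w \<in> carrier W \<Longrightarrow> phi (T w) = (if w = w0 then 1 else 0)"
  by (simp add: phi_def tr_T_mult mult_w0_eq_one)

lemma phi_inv_T: "w \<in> carrier W \<Longrightarrow> phi (inv (T w)) = (if w = w0 then 1 else 0)"
  using mult_w0_eq_one[of "inv_W w"] w0_inv
  by (auto simp: phi_def inv_T_w0 tr_simps)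

lemma phi_bar: "h \<in> carrier H \<Longrightarrow> phi (bar h) = A_bar (phi h)"
proof (induction h rule: H_induct)
  case (T w)
  moreover have "inv_W w = w0 \<longleftrightarrow> w = w0" using T w0_inv by auto
  ultimately show ?case by (simp add: bar_T phi_inv_T phi_T)
qed (simp_all add: bar_add bar_scale phi_add phi_scale A_bar_add A_bar_mult)

lemma phi_sigma: "h \<in> carrier H \<Longrightarrow> phi (sigma h) = sign w0 * phi h"
proof (induction h rule: H_induct)
  case (T w)
  then show ?case by (simp add: sigma_T phi_scale phi_inv_T phi_T)
qed (simp_all add: sigma_add sigma_scale phi_add phi_scale algebra_simps)

lemma phi_T_sigma_T:
  assumes "u \<in> carrier W" "v \<in> carrier W"
  shows "phi (T u \<otimes> sigma (T v)) = (if v = w0 \<bullet> u then sign v else 0)"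
proof -
  have "u \<bullet> (inv_W v \<bullet> w0) = \<one>\<^bsub>W\<^esub> \<longleftrightarrow> u = w0 \<bullet> v"
    using assms W.inv_equality[of u "inv_W v \<bullet> w0"] W.inv_mult_group[of "inv_W v" w0] w0_inv
    by auto (metis W.inv_inv W.inv_closed W.r_inv w0_closed W.m_closed)
  moreover have "u = w0 \<bullet> v \<longleftrightarrow> v = w0 \<bullet> u"
    using assms w0_cancel by auto
  ultimately show ?thesis
    using assms by (simp add: phi_def sigma_T H_simps m_assoc inv_T_w0 tr_simps tr_T_mult)
qed

end

section \<open>The dual of the Kazhdan--Lusztig basis\<close>

locale kl_algebra = finite_hecke W S L H w0
  for W :: "('w, 'b) monoid_scheme" and S :: "'w set"
    and L :: "'w \<Rightarrow> 'g::linordered_ab_group_add"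
    and H :: "('w, 'g) hecke monoid" (structure) and w0 :: 'w +
  fixes C :: "'w \<Rightarrow> ('w, 'g) hecke"
  assumes KL: "KL_basis W H C"
begin

lemma C_closed [simp]: "w \<in> carrier W \<Longrightarrow> C w \<in> carrier H"
  using KL by (simp add: KL_basis_def is_basis_def carrier_eq)

lemma C_bar: "w \<in> carrier W \<Longrightarrow> bar (C w) = C w"
  using KL by (simp add: KL_basis_def)

lemma C_lookup: "w \<in> carrier W \<Longrightarrow> u \<in> carrier W \<Longrightarrow>
    lookup (C w) u - (if w = u then 1 else 0) \<in> A_neg"
  using KL by (auto simp: KL_basis_def lookup_minus lookup_T)

text \<open>Up to sign and the factor \<open>T\<^sub>w\<^sub>0\<close> hidden in \<open>\<phi>\<close>, this is the basis dual to \<open>(C\<^sub>z)\<close> with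
  respect to \<open>\<tau>\<close>.\<close>

definition cdual :: "'w \<Rightarrow> ('w, 'g) hecke" where
  "cdual z = sigma (C (w0 \<bullet> z))"

lemma cdual_closed [simp]: "cdual z \<in> carrier H"
  by (simp add: cdual_def)

lemma phi_sigma_expansion:
  assumes "h \<in> carrier H" "k \<in> carrier H"
  shows "phi (h \<otimes> sigma k) = (\<Sum>u\<in>carrier W. sign (w0 \<bullet> u) * (lookup h u * lookup k (w0 \<bullet> u)))"
proof -
  have "phi (h \<otimes> sigma (T v)) = sign v * lookup h (w0 \<bullet> v)" if v: "v \<in> carrier W" for v
    using assms(1)
  proof (induction h rule: H_induct)
    case (T u)
    have "v = w0 \<bullet> u \<longleftrightarrow> u = w0 \<bullet> v" using T v w0_cancel by auto
    then show ?case using T v by (auto simp: phi_T_sigma_T lookup_T)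
  qed (simp_all add: H_simps phi_add phi_scale lookup_add lookup_scale algebra_simps)
  note 1 = this
  have bij: "bij_betw (\<lambda>u. w0 \<bullet> u) (carrier W) (carrier W)"
    by (rule bij_betwI[where g = "\<lambda>u. w0 \<bullet> u"]) (auto simp: w0_cancel)
  have "phi (h \<otimes> sigma k) = (\<Sum>v\<in>carrier W. lookup k v * (sign v * lookup h (w0 \<bullet> v)))"
    using assms(2)
  proof (induction k rule: H_induct)
    case (T v)
    then show ?case
      using fin by (simp add: 1 lookup_T if_distrib[of "\<lambda>c. c * _"] cong: if_cong)
  qed (use assms(1) in \<open>simp_all add: sigma_add sigma_scale H_simps phi_add phi_scale lookup_add
         lookup_scale ring_distribs sum.distrib sum_distrib_left mult.assoc\<close>)
  also have "\<dots> = (\<Sum>u\<in>carrier W. sign (w0 \<bullet> u) * (lookup h u * lookup k (w0 \<bullet> u)))"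
    by (subst sum.reindex_bij_betw[OF bij, symmetric]) (auto intro!: sum.cong simp: w0_cancel algebra_simps)
  finally show ?thesis .
qed

text \<open>The value is bar-invariant, and it differs from the claimed one by an element of
  \<open>A\<^bsub><0\<^esub>\<close>.\<close>

lemma phi_dual:
  assumes x: "x \<in> carrier W" and z: "z \<in> carrier W"
  shows "phi (C x \<otimes> cdual z) = (if x = z then sign (w0 \<bullet> z) else 0)" (is "?f = ?d")
proof -
  let ?\<delta> = "\<lambda>u v. (if u = v then 1 else 0) :: 'g group_ring"
  have "?d = (\<Sum>u\<in>carrier W. sign (w0 \<bullet> u) * (?\<delta> x u * ?\<delta> z u))"
  proof -
    have "sign (w0 \<bullet> u) * (?\<delta> x u * ?\<delta> z u) = (if u = x then ?d else 0)" for u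
      by simp
    then show ?thesis using x fin by simp
  qed
  moreover have "?f = (\<Sum>u\<in>carrier W. sign (w0 \<bullet> u) * (lookup (C x) u * lookup (C (w0 \<bullet> z)) (w0 \<bullet> u)))"
    using x z by (simp add: cdual_def phi_sigma_expansion)
  ultimately have "?f - ?d = (\<Sum>u\<in>carrier W. sign (w0 \<bullet> u) *
      (lookup (C x) u * lookup (C (w0 \<bullet> z)) (w0 \<bullet> u) - ?\<delta> x u * ?\<delta> z u))"
    by (simp add: sum_subtractf right_diff_distrib)
  also have "\<dots> \<in> A_neg"
  proof (intro A_neg_sum A_neg_sign)
    fix u assume u: "u \<in> carrier W"
    define a where "a = lookup (C x) u - ?\<delta> x u"
    define b where "b = lookup (C (w0 \<bullet> z)) (w0 \<bullet> u) - ?\<delta> z u"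
    have a: "a \<in> A_neg" using C_lookup x u by (simp add: a_def)
    have "w0 \<bullet> z = w0 \<bullet> u \<longleftrightarrow> z = u" using z u by simp
    then have b: "b \<in> A_neg" using C_lookup[of "w0 \<bullet> z" "w0 \<bullet> u"] z u by (simp add: b_def)
    have "lookup (C x) u * lookup (C (w0 \<bullet> z)) (w0 \<bullet> u) - ?\<delta> x u * ?\<delta> z u
        = a * b + a * ?\<delta> z u + ?\<delta> x u * b"
      by (simp add: a_def b_def algebra_simps)
    also have "\<dots> \<in> A_neg"
      using a b A_neg_mult[OF a b] by (auto intro!: A_neg_add simp: A_neg_zero)
    finally show "lookup (C x) u * lookup (C (w0 \<bullet> z)) (w0 \<bullet> u) - ?\<delta> x u * ?\<delta> z u \<in> A_neg" .
  qed
  finally have neg: "?f - ?d \<in> A_neg" .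
  have "A_bar ?f = phi (bar (C x \<otimes> cdual z))"
    using x by (simp add: phi_bar)
  also have "\<dots> = ?f"
    using x z by (simp add: bar_mult C_bar cdual_def bar_sigma)
  finally have "A_bar ?f = ?f" .
  then have "A_bar (?f - ?d) = ?f - ?d"
    using A_bar_add[of ?f "- ?d"] by (simp add: A_bar_uminus A_bar_sign)
  then have "?f - ?d = 0" using neg by (rule bar_invariant_A_neg_eq_0)
  then show ?thesis by simp
qed

abbreviation co :: "('w, 'g) hecke \<Rightarrow> 'w \<Rightarrow> 'g group_ring" where
  "co \<equiv> coord W C"

lemma C_expansion:
  assumes "h \<in> carrier H"
  shows "h = (\<Sum>w\<in>carrier W. scale (co h w) (C w))"
proof -
  have "\<exists>!c. c \<in> free_module W \<and> h = lincomb W C c"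
    using KL assms by (simp add: KL_basis_def is_basis_def carrier_eq)
  from theI'[OF this] show ?thesis
    by (simp add: coord_def lincomb_def)
qed

lemma co_eq:
  assumes h: "h \<in> carrier H" and x: "x \<in> carrier W"
  shows "co h x = sign (w0 \<bullet> x) * phi (h \<otimes> cdual x)"
proof -
  have "phi (h \<otimes> cdual x) = phi ((\<Sum>w\<in>carrier W. scale (co h w) (C w)) \<otimes> cdual x)"
    using C_expansion[OF h] by simp
  also have "\<dots> = (\<Sum>w\<in>carrier W. if w = x then co h w * sign (w0 \<bullet> x) else 0)"
    using x by (auto simp: sum_mult H_simps phi_sum phi_scale phi_dual intro!: sum.cong)
  also have "\<dots> = co h x * sign (w0 \<bullet> x)" using x fin by simp
  finally show ?thesis by (simp add: mult.left_commute)
qed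

lemma co_scale: "h \<in> carrier H \<Longrightarrow> x \<in> carrier W \<Longrightarrow> co (scale a h) x = a * co h x"
  by (simp add: co_eq H_simps phi_scale mult.left_commute)

lemma co_sum: "(\<And>i. i \<in> I \<Longrightarrow> f i \<in> carrier H) \<Longrightarrow> x \<in> carrier W \<Longrightarrow>
    co (\<Sum>i\<in>I. f i) x = (\<Sum>i\<in>I. co (f i) x)"
  by (simp add: co_eq sum_mult phi_sum sum_distrib_left)

lemma co_C: "w \<in> carrier W \<Longrightarrow> x \<in> carrier W \<Longrightarrow> co (C w) x = (if w = x then 1 else 0)"
  by (simp add: co_eq phi_dual)

lemma co_mult_C:
  assumes "h \<in> carrier H" "k \<in> carrier H" "x \<in> carrier W"
  shows "co (h \<otimes> k) x = (\<Sum>u\<in>carrier W. co k u * co (h \<otimes> C u) x)"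
proof -
  have "co (h \<otimes> k) x = co (h \<otimes> (\<Sum>u\<in>carrier W. scale (co k u) (C u))) x"
    using C_expansion[OF assms(2)] by simp
  also have "\<dots> = (\<Sum>u\<in>carrier W. co k u * co (h \<otimes> C u) x)"
    using assms by (simp add: mult_sum H_simps co_sum co_scale)
  finally show ?thesis .
qed

lemma co_C_mult:
  assumes "h \<in> carrier H" "k \<in> carrier H" "x \<in> carrier W"
  shows "co (h \<otimes> k) x = (\<Sum>u\<in>carrier W. co h u * co (C u \<otimes> k) x)"
proof -
  have "co (h \<otimes> k) x = co ((\<Sum>u\<in>carrier W. scale (co h u) (C u)) \<otimes> k) x"
    using C_expansion[OF assms(1)] by simp
  also have "\<dots> = (\<Sum>u\<in>carrier W. co h u * co (C u \<otimes> k) x)"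
    using assms by (simp add: sum_mult H_simps co_sum co_scale)
  finally show ?thesis .
qed

lemma co_bar:
  assumes "h \<in> carrier H" "x \<in> carrier W"
  shows "co (bar h) x = A_bar (co h x)"
proof -
  have "bar h \<otimes> cdual x = bar (h \<otimes> cdual x)"
    using assms by (simp add: bar_mult cdual_def bar_sigma C_bar)
  then show ?thesis using assms by (simp add: co_eq phi_bar A_bar_mult A_bar_sign)
qed

text \<open>In the expansion of \<open>\<phi>(T\<^sub>w\<^sub>0 \<sigma>(C\<^bsub>w0 z\<^esub>))\<close> only the coefficient of \<open>C\<^bsub>w0 z\<^esub>\<close> at
  \<open>w\<^sub>0 w\<^sub>0 = 1\<close> survives.\<close>

lemma co_T_w0: "z \<in> carrier W \<Longrightarrow> co (T w0) z = sign (w0 \<bullet> z) * tr (C (w0 \<bullet> z))"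
proof -
  assume z: "z \<in> carrier W"
  have "phi (T w0 \<otimes> cdual z) = (\<Sum>u\<in>carrier W. if u = w0 then tr (C (w0 \<bullet> z)) else 0)"
    using z by (auto simp: cdual_def phi_sigma_expansion lookup_T w0_square tau_def intro!: sum.cong)
  also have "\<dots> = tr (C (w0 \<bullet> z))" using fin by simp
  finally show ?thesis using z by (simp add: co_eq)
qed

section \<open>Multiplication by the longest element reverses the preorders\<close>

lemma cdual_w0: "x \<in> carrier W \<Longrightarrow> cdual (w0 \<bullet> x) = sigma (C x)" "x \<in> carrier W \<Longrightarrow> sigma (cdual x) = C (w0 \<bullet> x)"
  by (simp_all add: cdual_def w0_cancel sigma_sigma)

lemma T_w0_unit: "T w0 \<in> Units H"
  by simp

text \<open>Applying \<open>\<sigma>\<close> inside \<open>\<phi>\<close> exchanges the roles of \<open>C\<^sub>y\<close> and \<open>\<sigma>(C\<^bsub>w0 x\<^esub>)\<close> and puts \<open>\<sigma>(h)\<close> on the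
  far right.  As \<open>\<tau>\<close> is a trace, it may be moved back to the left at the price of a
  conjugation by \<open>T\<^sub>w\<^sub>0\<close>.\<close>

lemma left_step_w0:
  assumes "left_step W H C x y"
  shows "left_step W H C (w0 \<bullet> y) (w0 \<bullet> x)"
proof -
  from assms obtain h where xy: "x \<in> carrier W" "y \<in> carrier W" and h: "h \<in> carrier H"
    and nz: "co (h \<otimes> C y) x \<noteq> 0"
    by (auto simp: left_step_def)
  \<comment> \<open>chosen so that \<open>T\<^sub>w\<^sub>0 t = \<sigma>(h) T\<^sub>w\<^sub>0\<close>\<close>
  define t where "t = inv (T w0) \<otimes> (sigma h \<otimes> T w0)"
  have t: "t \<in> carrier H" by (simp add: t_def)
  let ?c = "C (w0 \<bullet> x) \<otimes> sigma (C y)"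
  have c: "?c \<in> carrier H" using xy by simp
  have "phi (sigma (h \<otimes> C y \<otimes> cdual x)) = phi (?c \<otimes> sigma h)"
    using xy h by (simp add: sigma_mult cdual_w0 m_assoc)
  also have "\<dots> = tr (?c \<otimes> (sigma h \<otimes> T w0))"
    using c by (simp add: phi_def m_assoc)
  also have "\<dots> = tr (?c \<otimes> (T w0 \<otimes> t))"
    by (simp add: t_def inv_T_cancel)
  also have "\<dots> = tr (t \<otimes> ?c \<otimes> T w0)"
    using tr_commute[of t "?c \<otimes> T w0"] t c by (simp add: m_assoc)
  also have "\<dots> = phi (t \<otimes> C (w0 \<bullet> x) \<otimes> cdual (w0 \<bullet> y))"
    using xy t by (simp add: phi_def cdual_w0 m_assoc)
  finally have eq: "phi (t \<otimes> C (w0 \<bullet> x) \<otimes> cdual (w0 \<bullet> y)) = sign w0 * phi (h \<otimes> C y \<otimes> cdual x)"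
    using xy h by (simp add: phi_sigma)
  have "phi (h \<otimes> C y \<otimes> cdual x) \<noteq> 0"
    using nz xy h by (auto simp: co_eq)
  then have "phi (t \<otimes> C (w0 \<bullet> x) \<otimes> cdual (w0 \<bullet> y)) \<noteq> 0"
    using eq by (metis sign_square(2) mult_zero_right)
  then have "co (t \<otimes> C (w0 \<bullet> x)) (w0 \<bullet> y) \<noteq> 0"
    using xy t by (metis C_closed W.m_closed co_eq m_closed mult_zero_right sign_square(2) w0_closed)
  then show ?thesis using xy t by (auto simp: left_step_def)
qed

text \<open>Here \<open>\<sigma>(h)\<close> lands in the middle, where it acts on \<open>C\<^bsub>w0 x\<^esub>\<close> from the right.\<close>

lemma right_step_w0:
  assumes "right_step W H C x y"
  shows "right_step W H C (w0 \<bullet> y) (w0 \<bullet> x)"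
proof -
  from assms obtain h where xy: "x \<in> carrier W" "y \<in> carrier W" and h: "h \<in> carrier H"
    and nz: "co (C y \<otimes> h) x \<noteq> 0"
    by (auto simp: right_step_def)
  have "phi (sigma (C y \<otimes> h \<otimes> cdual x)) = phi (C (w0 \<bullet> x) \<otimes> sigma h \<otimes> cdual (w0 \<bullet> y))"
    using xy h by (simp add: sigma_mult cdual_w0 m_assoc)
  then have eq: "phi (C (w0 \<bullet> x) \<otimes> sigma h \<otimes> cdual (w0 \<bullet> y)) = sign w0 * phi (C y \<otimes> h \<otimes> cdual x)"
    using xy h by (simp add: phi_sigma)
  have "phi (C y \<otimes> h \<otimes> cdual x) \<noteq> 0"
    using nz xy h by (auto simp: co_eq)
  then have "phi (C (w0 \<bullet> x) \<otimes> sigma h \<otimes> cdual (w0 \<bullet> y)) \<noteq> 0"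
    using eq by (metis sign_square(2) mult_zero_right)
  then have "co (C (w0 \<bullet> x) \<otimes> sigma h) (w0 \<bullet> y) \<noteq> 0"
    using xy by (metis C_closed W.m_closed co_eq m_closed mult_zero_right sigma_closed sign_square(2) w0_closed)
  then show ?thesis using xy by (auto simp: right_step_def)
qed

lemma le_L_w0: "le_L W H C x y \<Longrightarrow> le_L W H C (w0 \<bullet> y) (w0 \<bullet> x)"
  unfolding le_L_def
  by (induction rule: rtranclp_induct) (auto intro: left_step_w0 converse_rtranclp_into_rtranclp)

lemma le_LR_w0: "le_LR W H C x y \<Longrightarrow> le_LR W H C (w0 \<bullet> y) (w0 \<bullet> x)"
  unfolding le_LR_def
  by (induction rule: rtranclp_induct)
    (auto intro: left_step_w0 right_step_w0 converse_rtranclp_into_rtranclp)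

lemma T_w0_pow_unit: "T w0 [^] (n::nat) \<in> Units H"
  by (induction n) auto

lemma sigma_T_w0_pow: "sigma (T w0 [^] (n::nat)) = scale (sign w0 ^ n) (inv (T w0 [^] n))"
proof (induction n)
  case 0
  then show ?case by (simp add: sigma_one scale_simps)
next
  case (Suc n)
  then show ?case
    using inv_mult_Units[OF T_w0_pow_unit[of n] T_w0_unit] T_w0_pow_unit[of n]
    by (simp add: sigma_mult sigma_T H_simps scale_simps Units_closed mult.commute)
qed

lemma bar_T_w0_pow: "bar (T w0 [^] (n::nat)) = inv (T w0 [^] n)"
proof (induction n)
  case 0
  then show ?case by (simp add: bar_one)
next
  case (Suc n)
  have "inv (T w0 [^] Suc n) = inv (T w0 [^] n \<otimes> T w0)" by simp
  also have "\<dots> = inv (T w0 \<otimes> T w0 [^] n)"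
    by (simp only: nat_pow_Suc2[OF T_closed[OF w0_closed], symmetric] nat_pow_Suc)
  also have "\<dots> = inv (T w0 [^] n) \<otimes> inv (T w0)"
    using inv_mult_Units[OF T_w0_unit T_w0_pow_unit[of n]] by simp
  finally show ?case using Suc by (simp add: bar_mult bar_T w0_inv)
qed

lemma inv_T_w0_pow_commute: "T w0 \<otimes> inv (T w0 [^] (n::nat)) = inv (T w0 [^] n) \<otimes> T w0"
proof -
  let ?t = "T w0 [^] n"
  have t: "?t \<in> Units H" by (rule T_w0_pow_unit)
  have "T w0 \<otimes> inv ?t = inv ?t \<otimes> (?t \<otimes> T w0) \<otimes> inv ?t"
    using t by (simp add: m_assoc[symmetric] Units_closed)
  also have "?t \<otimes> T w0 = T w0 \<otimes> ?t"
    using nat_pow_Suc2[of "T w0" n] by simp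
  also have "inv ?t \<otimes> (T w0 \<otimes> ?t) \<otimes> inv ?t = inv ?t \<otimes> T w0"
    using t by (simp add: m_assoc Units_closed)
  finally show ?thesis .
qed

text \<open>As in the reversal of left steps, with \<open>h\<close> a power of \<open>T\<^sub>w\<^sub>0\<close>: \<open>\<sigma>\<close> inverts it up to
  sign, and conjugation by \<open>T\<^sub>w\<^sub>0\<close> fixes it.  Only the degree of the coordinate matters later,
  so the sign is left unspecified.\<close>

lemma co_inv_T_w0_pow:
  assumes x: "x \<in> carrier W" and y: "y \<in> carrier W"
  obtains k where "co (inv (T w0 [^] (n::nat)) \<otimes> C y) x =
    (- 1) ^ k * co (T w0 [^] n \<otimes> C (w0 \<bullet> x)) (w0 \<bullet> y)"
proof -
  let ?t = "T w0 [^] n"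
  have it: "inv ?t \<in> carrier H" using T_w0_pow_unit by simp
  let ?c = "C y \<otimes> cdual x"
  have c: "?c \<in> carrier H" using y by simp
  have "sign w0 * phi (?t \<otimes> C (w0 \<bullet> x) \<otimes> cdual (w0 \<bullet> y)) = phi (sigma (?t \<otimes> C (w0 \<bullet> x) \<otimes> cdual (w0 \<bullet> y)))"
    using x y by (simp add: phi_sigma)
  also have "sigma (?t \<otimes> C (w0 \<bullet> x) \<otimes> cdual (w0 \<bullet> y)) = scale (sign w0 ^ n) (?c \<otimes> inv ?t)"
    using x y it
    by (simp add: sigma_mult cdual_w0 sigma_sigma sigma_T_w0_pow H_simps m_assoc)
      (simp add: cdual_def)
  also have "phi \<dots> = sign w0 ^ n * phi (?c \<otimes> inv ?t)"
    using c it by (simp add: phi_scale)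
  also have "phi (?c \<otimes> inv ?t) = tr (?c \<otimes> (T w0 \<otimes> inv ?t))"
    using c it by (simp add: phi_def m_assoc inv_T_w0_pow_commute)
  also have "\<dots> = phi (inv ?t \<otimes> ?c)"
    using tr_commute[of "inv ?t" "?c \<otimes> T w0"] c it by (simp add: phi_def m_assoc)
  finally have "sign w0 * phi (?t \<otimes> C (w0 \<bullet> x) \<otimes> cdual (w0 \<bullet> y)) = sign w0 ^ n * phi (inv ?t \<otimes> ?c)" .
  then have "sign w0 * (sign (w0 \<bullet> (w0 \<bullet> y)) * co (?t \<otimes> C (w0 \<bullet> x)) (w0 \<bullet> y))
      = sign w0 ^ n * (sign (w0 \<bullet> x) * co (inv ?t \<otimes> C y) x)"
    using x y it by (simp add: co_eq m_assoc)
  then have eq: "(- 1) ^ (W.len w0 + W.len y) * co (?t \<otimes> C (w0 \<bullet> x)) (w0 \<bullet> y)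
      = (- 1) ^ (W.len w0 * n + W.len (w0 \<bullet> x)) * co (inv ?t \<otimes> C y) x" (is "?l = (- 1) ^ ?m * ?r")
    using y by (simp add: w0_cancel power_add power_mult mult.assoc)
  have "(- 1) ^ ?m * ?l = ((- 1) ^ ?m * (- 1) ^ ?m) * ?r"
    unfolding eq by (simp only: mult.assoc)
  also have "(- 1) ^ ?m * (- 1) ^ ?m = (1 :: 'g group_ring)"
    by (simp only: power_mult_distrib[symmetric]) simp
  finally have "?r = (- 1) ^ (?m + (W.len w0 + W.len y)) * co (?t \<otimes> C (w0 \<bullet> x)) (w0 \<bullet> y)"
    by (simp only: power_add mult.assoc mult_1_left)
  then show ?thesis by (rule that)
qed

end

section \<open>Bounding the action of the powers of \<open>T\<^sub>w\<^sub>0\<close>\<close>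

lemma deg_sign: "deg ((- 1) ^ k * a) = deg (a :: 'g::linordered_ab_group_add group_ring)"
proof -
  have "deg (- a) = deg a" for a :: "'g group_ring"
    by (simp add: deg_def)
  then show ?thesis by (induction k) simp_all
qed

lemma int_mult_mono: "g \<le> h \<Longrightarrow> int_mult (int n) g \<le> int_mult (int n) (h :: 'g::linordered_ab_group_add)"
  by (auto simp: int_mult_def intro: sum_mono)

locale kl_conjectures = kl_algebra W S L H w0 C
  for W :: "('w, 'b) monoid_scheme" and S :: "'w set"
    and L :: "'w \<Rightarrow> 'g::linordered_ab_group_add"
    and H :: "('w, 'g) hecke monoid" (structure) and w0 :: 'w and C :: "'w \<Rightarrow> ('w, 'g) hecke" +
  assumes P1: "P1 W H C" and P4: "P4 W H C" and P8: "P8 W H C"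
begin

abbreviation a :: "'w \<Rightarrow> 'g" where
  "a \<equiv> a_fun W H C"

definition a_drop :: "'w \<Rightarrow> 'g" where
  "a_drop x = a x - a (w0 \<bullet> x)"

text \<open>The maximum that defines \<open>\<a>(z)\<close> is an element of \<open>\<Gamma>\<close>: expanding \<open>1 C\<^sub>z = C\<^sub>z\<close> shows
  that \<open>C\<^sub>z\<close> occurs in some \<open>C\<^sub>u C\<^sub>z\<close>.\<close>

lemma deg_h_coeff_le:
  assumes x: "x \<in> carrier W" and y: "y \<in> carrier W" and z: "z \<in> carrier W"
  shows "deg (co (C x \<otimes> C y) z) \<le> Fin (a z)"
proof -
  let ?X = "(\<lambda>(x, y). deg (h_coeff W H C x y z)) ` (carrier W \<times> carrier W)"
  have X: "finite ?X" "?X \<noteq> {}" using fin x by auto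
  have "(\<Sum>u\<in>carrier W. co \<one> u * co (C u \<otimes> C z) z) = 1"
    using co_C_mult[of \<one> "C z" z] z by (simp add: co_C)
  then obtain u where u: "u \<in> carrier W" "co (C u \<otimes> C z) z \<noteq> 0"
    by (metis (no_types, lifting) mult_zero_right sum.neutral zero_neq_one)
  have "deg (h_coeff W H C u z z) \<le> Max ?X"
    using X u z by (intro Max_ge) (auto intro!: image_eqI[of _ _ "(u, z)"])
  then have "Max ?X \<noteq> Minf"
    using u by (auto simp: h_coeff_def deg_def)
  moreover have "Max ?X \<noteq> Pinf"
    using Max_in[OF X] by (auto simp: deg_not_Pinf) (metis deg_not_Pinf)
  ultimately have "Max ?X = Fin (a z)"
    unfolding a_fun_def by (cases "Max ?X") auto
  moreover have "deg (h_coeff W H C x y z) \<le> Max ?X"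
    using X x y by (intro Max_ge) (auto intro!: image_eqI[of _ _ "(x, y)"])
  ultimately show ?thesis by (simp add: h_coeff_def)
qed

text \<open>Degree exactly \<open>\<a>(z)\<close> means \<open>\<gamma>\<^bsub>x,y,z^-1\<^esub> \<noteq> 0\<close>, and then \<open>P\<^sub>8\<close> places \<open>y\<close> and \<open>z\<close> in the same
  left cell.\<close>

lemma deg_h_coeff_less:
  assumes x: "x \<in> carrier W" and y: "y \<in> carrier W" and z: "z \<in> carrier W"
    and "\<not> le_L W H C y z"
  shows "deg (co (C x \<otimes> C y) z) < Fin (a z)"
proof (rule ccontr)
  assume "\<not> ?thesis"
  then have "lookup (co (C x \<otimes> C y) z) (a z) \<noteq> 0"
    using deg_h_coeff_le[OF x y z] unfolding deg_le_iff deg_less_iff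
    by (metis in_keys_iff order_le_less)
  then have "gamma_coeff W H C x y (inv_W z) \<noteq> 0"
    using z by (simp add: gamma_coeff_def h_coeff_def)
  then have "sim_L W H C y (inv_W (inv_W z))"
    using P8 x y z unfolding P8_def by blast
  then show False using assms by (simp add: sim_L_def)
qed

lemma left_stepI: "h \<in> carrier H \<Longrightarrow> x \<in> carrier W \<Longrightarrow> y \<in> carrier W \<Longrightarrow> co (h \<otimes> C y) x \<noteq> 0 \<Longrightarrow> le_L W H C x y"
  unfolding le_L_def by (rule r_into_rtranclp) (auto simp: left_step_def)

lemma le_L_trans: "le_L W H C x y \<Longrightarrow> le_L W H C y z \<Longrightarrow> le_L W H C x z"
  by (simp add: le_L_def)

lemma le_L_imp_le_LR: "le_L W H C x y \<Longrightarrow> le_LR W H C x y"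
  unfolding le_L_def le_LR_def by (erule mono_rtranclp[rule_format, rotated]) blast

lemma a_antimono: "le_LR W H C x y \<Longrightarrow> x \<in> carrier W \<Longrightarrow> y \<in> carrier W \<Longrightarrow> a y \<le> a x"
  using P4 by (simp add: P4_def)

text \<open>Multiplication by \<open>w\<^sub>0\<close> reverses the preorder, and \<open>P\<^sub>4\<close> is applied to the reversed
  relation.\<close>

lemma a_w0_mono: "le_LR W H C x y \<Longrightarrow> x \<in> carrier W \<Longrightarrow> y \<in> carrier W \<Longrightarrow> a (w0 \<bullet> x) \<le> a (w0 \<bullet> y)"
  using a_antimono[OF le_LR_w0] by simp

lemma a_drop_antimono: "le_L W H C x y \<Longrightarrow> x \<in> carrier W \<Longrightarrow> y \<in> carrier W \<Longrightarrow> a_drop y \<le> a_drop x"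
  using a_antimono[OF le_L_imp_le_LR] a_w0_mono[OF le_L_imp_le_LR]
  unfolding a_drop_def by (intro diff_mono) auto

lemma deg_co_T_w0:
  assumes "z \<in> carrier W"
  shows "deg (co (T w0) z) \<le> Fin (- a (w0 \<bullet> z))"
proof -
  have "Fin (a (w0 \<bullet> z)) \<le> - deg (tr (C (w0 \<bullet> z)))"
    using P1 assms by (simp add: P1_def Delta_def)
  then have "deg (tr (C (w0 \<bullet> z))) \<le> Fin (- a (w0 \<bullet> z))"
    by (cases "deg (tr (C (w0 \<bullet> z)))") (auto simp: le_minus_iff)
  then show ?thesis using assms by (simp add: co_T_w0 deg_sign)
qed

text \<open>The case \<open>n = 1\<close>.  Every term of \<open>T\<^sub>w\<^sub>0 C\<^sub>y = \<Sum>\<^sub>z c\<^sub>z C\<^sub>z C\<^sub>y\<close> that contributes to \<open>C\<^sub>x\<close> has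
  \<open>x \<le>\<^sub>R z\<close>; so \<open>P\<^sub>1\<close> and \<open>P\<^sub>4\<close> bound \<open>c\<^sub>z\<close>, and the definition of \<open>\<a>\<close> bounds the other
  factor.\<close>

lemma deg_T_w0_mult:
  assumes x: "x \<in> carrier W" and y: "y \<in> carrier W"
  shows "deg (co (T w0 \<otimes> C y) x) \<le> Fin (a_drop x)"
    and "\<not> le_L W H C y x \<Longrightarrow> deg (co (T w0 \<otimes> C y) x) < Fin (a_drop x)"
proof -
  have eq: "co (T w0 \<otimes> C y) x = (\<Sum>z\<in>carrier W. co (T w0) z * co (C z \<otimes> C y) x)"
    using x y by (intro co_C_mult) auto
  have b: "a_drop x = - a (w0 \<bullet> x) + a x" by (simp add: a_drop_def)
  have c: "deg (co (T w0) z) \<le> Fin (- a (w0 \<bullet> x))"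
    if z: "z \<in> carrier W" and nz: "co (C z \<otimes> C y) x \<noteq> 0" for z
  proof -
    have "right_step W H C x z" using x y z nz by (auto simp: right_step_def)
    then have "le_LR W H C x z" by (auto simp: le_LR_def)
    then have "a (w0 \<bullet> x) \<le> a (w0 \<bullet> z)" using x z by (intro a_w0_mono)
    then have "Fin (- a (w0 \<bullet> z)) \<le> Fin (- a (w0 \<bullet> x))" by simp
    with deg_co_T_w0[OF z] show ?thesis by (rule order_trans)
  qed
  show "deg (co (T w0 \<otimes> C y) x) \<le> Fin (a_drop x)"
    unfolding eq
  proof (rule deg_sum_le)
    fix z assume z: "z \<in> carrier W"
    show "deg (co (T w0) z * co (C z \<otimes> C y) x) \<le> Fin (a_drop x)"
    proof (cases "co (C z \<otimes> C y) x = 0")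
      case False
      then show ?thesis
        unfolding b using c z deg_h_coeff_le x y by (intro deg_mult_le)
    qed (simp add: deg_def)
  qed
  assume nle: "\<not> le_L W H C y x"
  show "deg (co (T w0 \<otimes> C y) x) < Fin (a_drop x)"
    unfolding eq
  proof (rule deg_sum_less)
    fix z assume z: "z \<in> carrier W"
    show "deg (co (T w0) z * co (C z \<otimes> C y) x) < Fin (a_drop x)"
    proof (cases "co (C z \<otimes> C y) x = 0")
      case False
      then show ?thesis
        unfolding b using c z deg_h_coeff_less x y nle by (intro deg_mult_less_right)
    qed (simp add: deg_def)
  qed
qed

text \<open>In \<open>\<lambda>\<^sup>(\<^sup>n\<^sup>+\<^sup>1\<^sup>) = \<lambda>\<^sup>(\<^sup>1\<^sup>) \<lambda>\<^sup>(\<^sup>n\<^sup>)\<close> an intermediate index \<open>u\<close> satisfies \<open>x \<le>\<^sub>L u\<close>, so the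
  bound at \<open>u\<close> is at most the bound at \<open>x\<close>.  If \<open>y \<le>\<^sub>L x\<close> fails,
  then so does \<open>y \<le>\<^sub>L u\<close> or \<open>u \<le>\<^sub>L x\<close>, and the corresponding factor is strictly below its
  bound.\<close>

lemma deg_T_w0_pow_mult:
  assumes x: "x \<in> carrier W" and y: "y \<in> carrier W"
  shows "deg (co (T w0 [^] (n::nat) \<otimes> C y) x) \<le> Fin (int_mult (int n) (a_drop x)) \<and>
    (\<not> le_L W H C y x \<longrightarrow> deg (co (T w0 [^] n \<otimes> C y) x) < Fin (int_mult (int n) (a_drop x)))"
  using x
proof (induction n arbitrary: x)
  case 0
  have "le_L W H C y y" by (simp add: le_L_def)
  then show ?case using 0 y by (auto simp: co_C int_mult_0 deg_def)
next
  case (Suc n)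
  let ?c = "\<lambda>u. co (T w0 [^] n \<otimes> C y) u" and ?d = "\<lambda>u. co (T w0 \<otimes> C u) x"
  let ?N = "int_mult (int n) (a_drop x)"
  have eq: "co (T w0 [^] Suc n \<otimes> C y) x = (\<Sum>u\<in>carrier W. ?c u * ?d u)"
  proof -
    have "T w0 [^] Suc n \<otimes> C y = T w0 \<otimes> (T w0 [^] n \<otimes> C y)"
      using y nat_pow_Suc2[of "T w0" n] by (simp add: m_assoc del: nat_pow_Suc)
    then show ?thesis using Suc.prems y by (simp add: co_mult_C)
  qed
  have N: "int_mult (int (Suc n)) (a_drop x) = ?N + a_drop x"
    by (simp only: int_mult_add add.commute)
  have d: "deg (?d u) \<le> Fin (a_drop x)" "\<not> le_L W H C u x \<Longrightarrow> deg (?d u) < Fin (a_drop x)"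
    if "u \<in> carrier W" for u
    using deg_T_w0_mult Suc.prems that by auto
  have c: "deg (?c u) \<le> Fin ?N" "\<not> le_L W H C y u \<Longrightarrow> deg (?c u) < Fin ?N"
    if u: "u \<in> carrier W" and nz: "?d u \<noteq> 0" for u
  proof -
    have "le_L W H C x u" using left_stepI[of "T w0" x u] Suc.prems u nz by simp
    then have "int_mult (int n) (a_drop u) \<le> ?N"
      using a_drop_antimono[of x u] int_mult_mono Suc.prems u by blast
    then have le: "Fin (int_mult (int n) (a_drop u)) \<le> Fin ?N" by simp
    show "deg (?c u) \<le> Fin ?N" using Suc.IH[OF u] le by (meson order_trans)
    show "deg (?c u) < Fin ?N" if "\<not> le_L W H C y u"
      using Suc.IH[OF u] that le by (meson less_le_trans)
  qed
  have "deg (?c u * ?d u) \<le> Fin (?N + a_drop x)" if "u \<in> carrier W" for u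
  proof (cases "?d u = 0")
    case False
    then show ?thesis using c d that by (intro deg_mult_le)
  qed (simp add: deg_def)
  moreover have "deg (?c u * ?d u) < Fin (?N + a_drop x)"
    if "u \<in> carrier W" and nle: "\<not> le_L W H C y x" for u
  proof (cases "?d u = 0")
    case False
    from nle le_L_trans[of y u x] consider "\<not> le_L W H C y u" | "\<not> le_L W H C u x" by blast
    then show ?thesis
    proof cases
      case 1
      then show ?thesis using c d that False by (intro deg_mult_less_left)
    next
      case 2
      then show ?thesis using c d that False by (intro deg_mult_less_right)
    qed
  qed (simp add: deg_def)
  ultimately show ?case
    unfolding eq N by (auto intro: deg_sum_le deg_sum_less)
qed

text \<open>The bound for the positive power at the pair \<open>(w\<^sub>0 y, w\<^sub>0 x)\<close>, together with
  \<open>\<a>(w\<^sub>0 y) - \<a>(w\<^sub>0 w\<^sub>0 y) = -(\<a>(y) - \<a>(w\<^sub>0 y))\<close>.\<close>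

lemma deg_inv_T_w0_pow_mult:
  assumes x: "x \<in> carrier W" and y: "y \<in> carrier W"
  shows "deg (co (inv (T w0 [^] (n::nat)) \<otimes> C y) x) \<le> Fin (int_mult (- int n) (a_drop y)) \<and>
    (\<not> le_L W H C y x \<longrightarrow> deg (co (inv (T w0 [^] n) \<otimes> C y) x) < Fin (int_mult (- int n) (a_drop y)))"
proof -
  obtain k where "co (inv (T w0 [^] n) \<otimes> C y) x =
      (- 1) ^ k * co (T w0 [^] n \<otimes> C (w0 \<bullet> x)) (w0 \<bullet> y)"
    using co_inv_T_w0_pow[OF x y] .
  moreover have "a_drop (w0 \<bullet> y) = - a_drop y" using y by (simp add: a_drop_def w0_cancel)
  moreover have "le_L W H C (w0 \<bullet> x) (w0 \<bullet> y) \<Longrightarrow> le_L W H C y x"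
    using le_L_w0[of "w0 \<bullet> x" "w0 \<bullet> y"] x y by (simp add: w0_cancel)
  ultimately show ?thesis
    using deg_T_w0_pow_mult[of "w0 \<bullet> y" "w0 \<bullet> x" n] x y
    by (auto simp: deg_sign int_mult_uminus(1))
qed

section \<open>Specialization at \<open>v = 1\<close>\<close>

text \<open>Equality of images in the integral group ring of \<open>W\<close>, that is, after putting \<open>v = 1\<close>.\<close>

definition aug_eq :: "('w, 'g) hecke \<Rightarrow> ('w, 'g) hecke \<Rightarrow> bool" where
  "aug_eq h k \<longleftrightarrow> (\<forall>w. aug (lookup h w) = aug (lookup k w))"

lemma aug_eq_refl: "aug_eq h h"
  and aug_eq_trans: "aug_eq h k \<Longrightarrow> aug_eq k l \<Longrightarrow> aug_eq h l"
  by (simp_all add: aug_eq_def)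

lemma aug_eq_mult:
  assumes "aug_eq h k" "h \<in> carrier H" "k \<in> carrier H" "l \<in> carrier H"
  shows "aug_eq (h \<otimes> l) (k \<otimes> l)" "aug_eq (l \<otimes> h) (l \<otimes> k)"
proof -
  have left: "aug (lookup (m \<otimes> l) u) = (\<Sum>w\<in>carrier W. aug (lookup m w) * aug (lookup (T w \<otimes> l) u))"
    if "m \<in> carrier H" for m u
  proof -
    have "m \<otimes> l = (\<Sum>w\<in>carrier W. scale (lookup m w) (T w)) \<otimes> l"
      using T_expansion[OF that] by simp
    then show ?thesis using assms
      by (simp add: sum_mult H_simps lookup_sum lookup_scale aug_sum aug_mult)
  qed
  have right: "aug (lookup (l \<otimes> m) u) = (\<Sum>w\<in>carrier W. aug (lookup m w) * aug (lookup (l \<otimes> T w) u))"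
    if "m \<in> carrier H" for m u
  proof -
    have "l \<otimes> m = l \<otimes> (\<Sum>w\<in>carrier W. scale (lookup m w) (T w))"
      using T_expansion[OF that] by simp
    then show ?thesis using assms
      by (simp add: mult_sum H_simps lookup_sum lookup_scale aug_sum aug_mult)
  qed
  show "aug_eq (h \<otimes> l) (k \<otimes> l)" "aug_eq (l \<otimes> h) (l \<otimes> k)"
    using assms by (simp_all add: aug_eq_def left right)
qed

lemma aug_eq_T_square: "s \<in> S \<Longrightarrow> aug_eq (T s \<otimes> T s) \<one>"
  by (simp add: aug_eq_def T_square lookup_add lookup_scale aug_add aug_mult xi_def aug_diff)

text \<open>At \<open>v = 1\<close> the generators become involutions, so a reduced word times its reverse
  collapses from the middle.\<close>

lemma aug_eq_T_inv: "w \<in> carrier W \<Longrightarrow> aug_eq (T w \<otimes> T (inv_W w)) \<one>"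
proof (induction w rule: W.len_induct)
  case one
  then show ?case by (simp add: T_one aug_eq_refl)
next
  case (step s u)
  let ?m = "T u \<otimes> T (inv_W u)"
  have "T (s \<bullet> u) \<otimes> T (inv_W (s \<bullet> u)) = T s \<otimes> ?m \<otimes> T s"
    using step by (simp add: W.inv_mult_group W.S_inv T_inv_step T_left_up[symmetric] m_assoc)
  moreover have "aug_eq (T s \<otimes> ?m \<otimes> T s) (T s \<otimes> \<one> \<otimes> T s)"
    using step by (intro aug_eq_mult) auto
  ultimately show ?case
    using aug_eq_T_square[of s] step by (auto intro: aug_eq_trans)
qed

lemma aug_eq_T_w0_pow: "aug_eq (T w0 [^] (2 * n)) \<one>" for n :: nat
proof (induction n)
  case 0
  then show ?case by (simp add: aug_eq_refl)
next
  case (Suc n)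
  have "aug_eq (T w0 [^] (2 * n) \<otimes> (T w0 \<otimes> T w0)) (\<one> \<otimes> (T w0 \<otimes> T w0))"
    using Suc by (intro aug_eq_mult) auto
  moreover have "aug_eq (T w0 \<otimes> T w0) \<one>"
    using aug_eq_T_inv[of w0] by (simp add: w0_inv)
  ultimately show ?case by (auto simp: m_assoc intro: aug_eq_trans)
qed

text \<open>The coordinates of \<open>h\<close> are obtained from \<open>h\<close> by multiplications and \<open>\<tau>\<close>, and these operations are
  compatible with the specialization.\<close>

lemma aug_co_cong:
  assumes "aug_eq h k" "h \<in> carrier H" "k \<in> carrier H" "x \<in> carrier W"
  shows "aug (co h x) = aug (co k x)"
proof -
  have "aug_eq (h \<otimes> cdual x \<otimes> T w0) (k \<otimes> cdual x \<otimes> T w0)"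
    using assms by (intro aug_eq_mult) auto
  then show ?thesis
    using assms by (simp add: co_eq aug_mult phi_def tau_def aug_eq_def)
qed

lemma aug_co_T_w0_pow:
  assumes "even n" "x \<in> carrier W" "y \<in> carrier W"
  shows "aug (co (T w0 [^] (n::nat) \<otimes> C y) x) = (if x = y then 1 else 0)"
proof -
  have "aug_eq (T w0 [^] n) \<one>" using assms(1) aug_eq_T_w0_pow by (auto elim: evenE)
  then have "aug_eq (T w0 [^] n \<otimes> C y) (\<one> \<otimes> C y)"
    using assms by (intro aug_eq_mult) auto
  then have "aug (co (T w0 [^] n \<otimes> C y) x) = aug (co (\<one> \<otimes> C y) x)"
    using assms by (intro aug_co_cong) auto
  then show ?thesis using assms by (simp add: co_C)
qed

lemma co_inv_T_w0_pow_bar: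
  assumes "x \<in> carrier W" "y \<in> carrier W"
  shows "co (inv (T w0 [^] (n::nat)) \<otimes> C y) x = A_bar (co (T w0 [^] n \<otimes> C y) x)"
  using assms by (simp add: co_bar[symmetric] bar_mult bar_T_w0_pow C_bar)

text \<open>The bound for \<open>n\<close> and the bound for \<open>-n\<close> applied to the bar conjugate leave the single
  exponent \<open>n (\<a>(x) - \<a>(w\<^sub>0 x))\<close>; the coefficient is read off at \<open>v = 1\<close>.\<close>

lemma co_T_w0_pow_even:
  assumes n: "even n" and x: "x \<in> carrier W" and y: "y \<in> carrier W" and sim: "sim_L W H C x y"
  shows "co (T w0 [^] (n::nat) \<otimes> C y) x = (if x = y then v_pow (int_mult (int n) (a_drop x)) else 0)"
proof -
  let ?l = "co (T w0 [^] n \<otimes> C y) x" and ?g = "int_mult (int n) (a_drop x)"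
  have b: "a_drop y = a_drop x"
    using sim a_drop_antimono x y by (intro antisym) (auto simp: sim_L_def)
  have keys: "Poly_Mapping.keys ?l \<subseteq> {?g}"
  proof
    fix k assume k: "k \<in> Poly_Mapping.keys ?l"
    have "k \<le> ?g"
      using deg_T_w0_pow_mult[OF x y, of n] k by (simp add: deg_le_iff)
    have "deg (A_bar ?l) \<le> Fin (- ?g)"
      using deg_inv_T_w0_pow_mult[OF x y, of n] co_inv_T_w0_pow_bar[OF x y, of n]
      by (simp add: b int_mult_uminus(2))
    moreover have "- k \<in> Poly_Mapping.keys (A_bar ?l)"
      using k by (simp add: keys_A_bar)
    ultimately have "- k \<le> - ?g" unfolding deg_le_iff by blast
    with \<open>k \<le> ?g\<close> show "k \<in> {?g}" by simp
  qed
  then have l: "?l = Poly_Mapping.single ?g (lookup ?l ?g)"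
    by (intro poly_mapping_eqI) (auto simp: lookup_single when_def in_keys_iff)
  have "lookup ?l ?g = (if x = y then 1 else 0)"
    using aug_co_T_w0_pow[OF n x y] by (subst (asm) l) simp
  then show ?thesis by (subst l) (simp add: v_pow_def)
qed

lemma lambda_nat: "lambda_coeff W H C w0 (int n) x y = co (T w0 [^] n \<otimes> C y) x"
  by (simp add: lambda_coeff_def int_pow_int)

lemma lambda_neg: "lambda_coeff W H C w0 (- int n) x y = co (inv (T w0 [^] n) \<otimes> C y) x"
proof -
  have "T w0 [^] (- int n) = inv (T w0 [^] n)"
  proof (cases "n = 0")
    case False
    then show ?thesis by (subst int_pow_def2) (simp only: of_nat_0_less_iff neg_less_0_iff_less nat_int minus_minus neq0_conv if_True)
  qed (simp del: nat_pow_Suc)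
  then show ?thesis by (simp only: lambda_coeff_def)
qed

end

theorem proposition1p4:
  fixes W :: "('w, 'b) monoid_scheme" and S :: "'w set"
    and L :: "'w \<Rightarrow> 'g::linordered_ab_group_add"
    and H :: "('w, 'g) hecke monoid" and C :: "'w \<Rightarrow> ('w, 'g) hecke"
    and w0 x y :: 'w and n :: int
  assumes "coxeter_system W S" and "finite (carrier W)"
    and "longest_element W S w0"
    and "weight_function W S L" and "\<forall>s\<in>S. L s > 0"
    and "hecke_algebra W S L H" and "KL_basis W H C"
    and "P1 W H C" and "P4 W H C" and "P8 W H C"
    and "x \<in> carrier W" and "y \<in> carrier W" and "le_L W H C x y"
  shows
    "(n \<ge> 0 \<longrightarrow>
        deg (lambda_coeff W H C w0 n x y)
          \<le> Fin (int_mult n (a_fun W H C x - a_fun W H C (w0 \<otimes>\<^bsub>W\<^esub> x))) \<and>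
        (less_L W H C x y \<longrightarrow>
          deg (lambda_coeff W H C w0 n x y)
            < Fin (int_mult n (a_fun W H C x - a_fun W H C (w0 \<otimes>\<^bsub>W\<^esub> x))))) \<and>
     (n \<le> 0 \<longrightarrow>
        deg (lambda_coeff W H C w0 n x y)
          \<le> Fin (int_mult n (a_fun W H C y - a_fun W H C (w0 \<otimes>\<^bsub>W\<^esub> y))) \<and>
        (less_L W H C x y \<longrightarrow>
          deg (lambda_coeff W H C w0 n x y)
            < Fin (int_mult n (a_fun W H C y - a_fun W H C (w0 \<otimes>\<^bsub>W\<^esub> y))))) \<and>
     (even n \<and> sim_L W H C x y \<longrightarrow>
        lambda_coeff W H C w0 n x y =
          (if x = y then v_pow (int_mult n (a_fun W H C x - a_fun W H C (w0 \<otimes>\<^bsub>W\<^esub> x))) else 0))"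
proof -
  interpret kl_conjectures W S L H w0 C
    using assms
    by (simp add: kl_conjectures_def kl_conjectures_axioms_def kl_algebra_def kl_algebra_axioms_def
        finite_hecke_def finite_hecke_axioms_def)
  note x = \<open>x \<in> carrier W\<close> and y = \<open>y \<in> carrier W\<close>
  have nle: "less_L W H C x y \<Longrightarrow> \<not> le_L W H C y x"
    by (simp add: less_L_def sim_L_def)
  show ?thesis
    unfolding a_drop_def[symmetric]
  proof (intro conjI impI)
    assume "n \<ge> 0"
    then obtain m where n: "n = int m" using nonneg_int_cases by blast
    show "deg (lambda_coeff W H C w0 n x y) \<le> Fin (int_mult n (a_drop x))"
      using deg_T_w0_pow_mult[OF x y, of m] by (simp add: n lambda_nat)
    show "deg (lambda_coeff W H C w0 n x y) < Fin (int_mult n (a_drop x))" if "less_L W H C x y"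
      using deg_T_w0_pow_mult[OF x y, of m] nle[OF that] by (simp add: n lambda_nat)
  next
    assume "n \<le> 0"
    then obtain m where n: "n = - int m" using nonpos_int_cases by blast
    show "deg (lambda_coeff W H C w0 n x y) \<le> Fin (int_mult n (a_drop y))"
      using deg_inv_T_w0_pow_mult[OF x y, of m] by (simp add: n lambda_neg)
    show "deg (lambda_coeff W H C w0 n x y) < Fin (int_mult n (a_drop y))" if "less_L W H C x y"
      using deg_inv_T_w0_pow_mult[OF x y, of m] nle[OF that] by (simp add: n lambda_neg)
  next
    assume *: "even n \<and> sim_L W H C x y"
    obtain m where "n = int m \<or> n = - int m" by (metis int_cases2)
    moreover from this have "even m" using * by auto
    ultimately show "lambda_coeff W H C w0 n x y = (if x = y then v_pow (int_mult n (a_drop x)) else 0)"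
      using co_T_w0_pow_even[OF _ x y, of m] *
      by (auto simp: lambda_nat lambda_neg co_inv_T_w0_pow_bar x y A_bar_v_pow int_mult_uminus(2))
  qed
qed

end
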